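(* Let $q\in L^1(0,\infty)$ be real-valued and let $H^N$ be the self-adjoint operator in $L^2(0,\infty)$ given by $H^N\varphi=-\varphi''+(x+q(x))\varphi$ on the domain of $\varphi\in L^2(0,\infty)$ with $\varphi,\varphi'$ locally absolutely continuous on $[0,\infty)$, $-\varphi''+(x+q)\varphi\in L^2(0,\infty)$, and $\varphi'(0)=0$. Let $\lambda_1^N<\lambda_2^N<\cdots$ be its (simple) eigenvalues, and define the norming constants $\nu_k^N$ by \[ \frac{1}{\nu_k^N}=\frac{\|\varphi_k\|_{L^2(0,\infty)}^2}{\big(\varphi_k(0)\big)^2}, \] where $\varphi_k$ is any nonzero eigenfunction of $H^N$ for $\lambda_k^N$. Then \[ \frac{1}{\nu_k^N}=\left(\tfrac32\pi\big(k-\tfrac34\big)\right)^{2/3}\big(1+o(1)\big),\qquad k\to\infty. \]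
   Context: The quotient defining $\nu_k^N$ does not depend on the choice of the (one-dimensional) eigenfunction $\varphi_k$. *)

theory Defs
  imports "HOL-Analysis.Analysis" "HOL-Library.Landau_Symbols"
begin

text \<open>Locally absolute continuity on [0,\<infinity>) is expressed literally via the
Lebesgue fundamental theorem: f x = f 0 + integral of an L^1_loc function g over [0,x].\<close>

definition loc_AC_deriv :: "(real \<Rightarrow> real) \<Rightarrow> (real \<Rightarrow> real) \<Rightarrow> bool" where
  "loc_AC_deriv f g \<longleftrightarrow>
     (\<forall>x\<ge>0. g absolutely_integrable_on {0..x} \<and> f x = f 0 + integral {0..x} g)"

definition is_eigenfunction_N ::
  "(real \<Rightarrow> real) \<Rightarrow> real \<Rightarrow> (real \<Rightarrow> real) \<Rightarrow> bool" where
  "is_eigenfunction_N q lam phi \<longleftrightarrow>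
     (\<exists>phi1 phi2.
        loc_AC_deriv phi phi1 \<and> loc_AC_deriv phi1 phi2 \<and>
        (\<lambda>x. (phi x)\<^sup>2) integrable_on {0..} \<and>
        (\<lambda>x. (- phi2 x + (x + q x) * phi x)\<^sup>2) integrable_on {0..} \<and>
        phi1 0 = 0 \<and>
        (AE x in lebesgue. 0 \<le> x \<longrightarrow> - phi2 x + (x + q x) * phi x = lam * phi x)) \<and>
     (\<exists>x\<ge>0. phi x \<noteq> 0)"

definition eigenvalues_N :: "(real \<Rightarrow> real) \<Rightarrow> real set" where
  "eigenvalues_N q = {lam. \<exists>phi. is_eigenfunction_N q lam phi}"

definition eigenvalue_N :: "(real \<Rightarrow> real) \<Rightarrow> nat \<Rightarrow> real" where
  "eigenvalue_N q k =
     (THE lam. lam \<in> eigenvalues_N q \<and> card {m \<in> eigenvalues_N q. m < lam} = k - 1)"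

definition inv_norming_const_N :: "(real \<Rightarrow> real) \<Rightarrow> nat \<Rightarrow> real" where
  "inv_norming_const_N q k =
     (let phi = (SOME phi. is_eigenfunction_N q (eigenvalue_N q k) phi)
      in integral {0..} (\<lambda>x. (phi x)\<^sup>2) / (phi 0)\<^sup>2)"

end

theory Submission
  imports Defs "HOL-Real_Asymp.Real_Asymp"
begin

text \<open>
  With \<open>Q(x) = \<integral>\<^sub>0\<^sup>x q\<close> and the quasi-derivative \<open>v = u' - Q u\<close>, the eigenvalue equation becomes the
  system \<open>u' = Q u + v\<close>, \<open>v' = (x - lam - Q\<^sup>2) u - Q v\<close> with continuous coefficients.

  Eigenvalues. The Pruefer angle \<open>theta\<close> of \<open>(u, v)\<close>, started at \<open>\<pi>/2\<close>, increases with \<open>lam\<close>. In the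
  forbidden region, where \<open>x - lam - Q\<^sup>2 \<ge> 1\<close>, one has \<open>(u v)' \<ge> u\<^sup>2 + v\<^sup>2\<close>, so that \<open>u\<close> is square
  integrable iff \<open>u v\<close> stays negative there, i.e. iff \<open>theta\<close> stays in an interval
  \<open>((m + 1/2) \<pi>, (m + 1) \<pi>)\<close>; a connectedness argument in \<open>lam\<close> gives exactly one such \<open>lam = mu m\<close> for
  every \<open>m\<close>. Rescaling the angle by \<open>\<surd>(lam - x)\<close> shows that it equals \<open>2/3 lam\<^bsup>3/2\<^esup> + O(lam)\<close> at the
  turning point, whence \<open>mu m \<sim> (3/2 \<pi> m)\<^bsup>2/3\<^esup>\<close>.

  Norming constants. The energy \<open>E = u'\<^sup>2 + (lam - x) u\<^sup>2\<close> satisfies \<open>E' = - u\<^sup>2 + 2 q u u'\<close>, \<open>E(0) = lam\<close>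
  and \<open>E(\<infinity>) = 0\<close>, so that \<open>\<integral> u\<^sup>2 = lam + 2 \<integral> q u u'\<close>. The last integral is \<open>o(lam)\<close>:
  \<open>u u' = O(lam\<^bsup>1/2\<^esup>)\<close> on \<open>[0, lam/2]\<close>, while \<open>u u' = O(lam)\<close> everywhere and the tail of \<open>q\<close> is small.
\<close>

subsection \<open>One-sided derivatives and differential inequalities\<close>

lemma mvt_within:
  fixes f f' :: "real \<Rightarrow> real"
  assumes "a < b" and "{a..b} \<subseteq> S"
    and der: "\<And>x. x \<in> {a..b} \<Longrightarrow> (f has_real_derivative f' x) (at x within S)"
  shows "\<exists>x\<in>{a<..<b}. f b - f a = f' x * (b - a)"
proof (rule mvt_simple[OF \<open>a < b\<close>])
  fix x assume "a \<le> x" "x \<le> b"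
  then have "(f has_real_derivative f' x) (at x within {a..b})"
    using der[of x] \<open>{a..b} \<subseteq> S\<close> by (auto intro: DERIV_subset)
  then show "(f has_derivative (*) (f' x)) (at x within {a..b})"
    by (simp add: has_field_derivative_def)
qed

lemma DERIV_within_nonneg_imp_le:
  fixes f f' :: "real \<Rightarrow> real"
  assumes "a \<le> b" "{a..b} \<subseteq> S"
    and "\<And>x. x \<in> {a..b} \<Longrightarrow> (f has_real_derivative f' x) (at x within S)"
    and "\<And>x. x \<in> {a<..<b} \<Longrightarrow> 0 \<le> f' x"
  shows "f a \<le> f b"
proof (cases "a = b")
  case False
  then have "\<exists>x\<in>{a<..<b}. f b - f a = f' x * (b - a)"
    using assms(1) by (intro mvt_within[OF _ assms(2,3)]) auto
  then show ?thesis
    using assms(1,4) by (metis diff_ge_0_iff_ge mult_nonneg_nonneg)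
qed simp

lemma DERIV_within_pos_imp_less:
  fixes f f' :: "real \<Rightarrow> real"
  assumes "a < b" "{a..b} \<subseteq> S"
    and "\<And>x. x \<in> {a..b} \<Longrightarrow> (f has_real_derivative f' x) (at x within S)"
    and "\<And>x. x \<in> {a<..<b} \<Longrightarrow> 0 < f' x"
  shows "f a < f b"
  using mvt_within[OF assms(1-3)] assms(1,4) by (metis diff_gt_0_iff_gt mult_pos_pos)

lemma gronwall_within:
  fixes F F' :: "real \<Rightarrow> real"
  assumes "a \<le> b" "{a..b} \<subseteq> S"
    and der: "\<And>x. x \<in> {a..b} \<Longrightarrow> (F has_real_derivative F' x) (at x within S)"
    and deriv_le: "\<And>x. x \<in> {a<..<b} \<Longrightarrow> F' x \<le> L * F x"
  shows "F b \<le> F a * exp (L * (b - a))"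
proof -
  have "- (F a * exp (- L * a)) \<le> - (F b * exp (- L * b))"
  proof (rule DERIV_within_nonneg_imp_le[OF assms(1,2)])
    fix x assume x: "x \<in> {a..b}"
    show "((\<lambda>x. - (F x * exp (- L * x))) has_real_derivative (L * F x - F' x) * exp (- L * x))
        (at x within S)"
      by (auto intro!: derivative_eq_intros der[OF x] simp: algebra_simps)
  next
    fix x assume "x \<in> {a<..<b}"
    then show "0 \<le> (L * F x - F' x) * exp (- L * x)"
      using deriv_le by simp
  qed
  then have "F b * exp (- L * b) * exp (L * b) \<le> F a * exp (- L * a) * exp (L * b)"
    by (intro mult_right_mono) auto
  then show ?thesis
    by (simp add: exp_minus exp_diff field_simps)
qed

lemma DERIV_within_imp_continuous_on:
  fixes f :: "real \<Rightarrow> real"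
  assumes "\<And>x. x \<in> S \<Longrightarrow> (f has_real_derivative f' x) (at x within S)"
  shows "continuous_on S f"
  using assms DERIV_continuous continuous_on_eq_continuous_within by blast

text \<open>Gronwall's inequality applies to \<open>- d\<close> after the last point at which \<open>d \<ge> 0\<close>.\<close>

lemma differential_inequality_nonneg:
  fixes d d' :: "real \<Rightarrow> real"
  assumes "a \<le> b" "{a..b} \<subseteq> S"
    and der: "\<And>x. x \<in> {a..b} \<Longrightarrow> (d has_real_derivative d' x) (at x within S)"
    and deriv_ge: "\<And>x. x \<in> {a..b} \<Longrightarrow> - L * \<bar>d x\<bar> \<le> d' x"
    and "0 \<le> d a"
  shows "0 \<le> d b"
proof -
  have "continuous_on {a..b} d"
    by (rule DERIV_within_imp_continuous_on[where f' = d'])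
      (use der \<open>{a..b} \<subseteq> S\<close> in \<open>auto intro: DERIV_subset\<close>)
  then have "closed {x \<in> {a..b}. 0 \<le> d x}"
    by (intro continuous_on_closed_Collect_le continuous_on_const) auto
  then have "compact {x \<in> {a..b}. 0 \<le> d x}"
    by (auto simp: compact_eq_bounded_closed intro: bounded_subset[of "{a..b}"])
  moreover have "a \<in> {x \<in> {a..b}. 0 \<le> d x}"
    using assms by simp
  ultimately obtain c where c: "c \<in> {a..b}" "0 \<le> d c"
    and last: "\<And>x. x \<in> {a..b} \<Longrightarrow> 0 \<le> d x \<Longrightarrow> x \<le> c"
    using compact_attains_sup[of "{x \<in> {a..b}. 0 \<le> d x}"] by blast
  have "- d b \<le> - d c * exp (L * (b - c))"
  proof (rule gronwall_within[of c b S])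
    show "((\<lambda>x. - d x) has_real_derivative - d' x) (at x within S)" if "x \<in> {c..b}" for x
      using der[of x] that c by (auto intro: derivative_intros)
    show "- d' x \<le> L * - d x" if "x \<in> {c<..<b}" for x
      using deriv_ge[of x] last[of x] that c by force
  qed (use c assms in auto)
  then show ?thesis
    using mult_nonneg_nonneg[OF c(2), of "exp (L * (b - c))"] by simp
qed

lemma integral_has_vector_derivative_atLeast:
  fixes g :: "real \<Rightarrow> 'a::banach"
  assumes "continuous_on {a..} g" "a \<le> t"
  shows "((\<lambda>x. integral {a..x} g) has_vector_derivative g t) (at t within {a..})"
proof -
  have "((\<lambda>x. integral {a..x} g) has_vector_derivative g t) (at t within {a..t+1})"
    by (rule integral_has_vector_derivative) (use assms in \<open>auto intro: continuous_on_subset\<close>)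
  moreover have "at t within {a..t+1} = at t within {a..}"
    by (rule at_within_nhd[of _ "{..<t+1}"]) auto
  ultimately show ?thesis by simp
qed

lemma integral_Icc_diff:
  fixes f :: "real \<Rightarrow> 'a::banach"
  assumes "a \<le> c" "c \<le> b" "f integrable_on {a..b}"
  shows "integral {a..b} f - integral {a..c} f = integral {c..b} f"
  using Henstock_Kurzweil_Integration.integral_combine[OF assms] by (simp add: algebra_simps)

lemma continuous_on_atLeast_imp_integrable_on_Icc:
  fixes f :: "real \<Rightarrow> 'a::banach"
  assumes "continuous_on {c..} f" "c \<le> a"
  shows "f integrable_on {a..b}"
  by (rule integrable_continuous_real) (use assms in \<open>auto intro: continuous_on_subset\<close>)

subsection \<open>Global solutions of Lipschitz initial value problems\<close>

locale lipschitz_ivp =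
  fixes f :: "real \<Rightarrow> 'a::banach \<Rightarrow> 'a" and L :: "real \<Rightarrow> real" and t0 :: real and y0 :: 'a
  assumes continuous_field: "continuous_on ({t0..} \<times> UNIV) (\<lambda>(t, y). f t y)"
    and continuous_lipschitz_const: "continuous_on {t0..} L"
    and lipschitz: "\<And>t y z. t0 \<le> t \<Longrightarrow> dist (f t y) (f t z) \<le> L t * dist y z"
begin

definition rate :: "real \<Rightarrow> real" where
  "rate t = \<bar>L t\<bar> + norm (f t y0)"

definition weight :: "real \<Rightarrow> real" where
  "weight t = exp (2 * integral {t0..t} rate)"

definition field_along :: "(real \<Rightarrow> 'a) \<Rightarrow> real \<Rightarrow> 'a" where
  "field_along g t = f t (y0 + weight t *\<^sub>R g t)"

text \<open>Writing \<open>y = y0 + weight *\<^sub>R g\<close> turns the integral equation for \<open>y\<close> into a fixed point equation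
  for \<open>g\<close> that is a contraction on the bounded continuous functions on the whole half line. The
  argument is clamped because bounded continuous functions live on a whole type.\<close>

definition picard :: "(real \<Rightarrow> 'a) \<Rightarrow> real \<Rightarrow> 'a" where
  "picard g x = (1 / weight (max t0 x)) *\<^sub>R integral {t0..max t0 x} (field_along g)"

lemma weight_pos: "0 < weight t"
  by (simp add: weight_def)

lemma rate_nonneg: "0 \<le> rate t"
  by (simp add: rate_def)

lemma continuous_rate: "continuous_on {t0..} rate"
proof -
  have "continuous_on {t0..} (\<lambda>t. f t y0)"
    by (rule continuous_on_compose2[OF continuous_field, of _ "\<lambda>t. (t, y0)", simplified])
      (auto intro!: continuous_intros)
  then show ?thesis
    unfolding rate_def by (intro continuous_intros continuous_lipschitz_const)
qed

lemma weight_deriv: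
  assumes "t0 \<le> t"
  shows "(weight has_real_derivative 2 * rate t * weight t) (at t within {t0..})"
proof -
  have "((\<lambda>t. integral {t0..t} rate) has_real_derivative rate t) (at t within {t0..})"
    unfolding has_real_derivative_iff_has_vector_derivative
    by (rule integral_has_vector_derivative_atLeast[OF continuous_rate assms])
  then show ?thesis
    unfolding weight_def by (auto intro!: derivative_eq_intros)
qed

lemma continuous_weight: "continuous_on {t0..} weight"
  by (rule DERIV_within_imp_continuous_on) (auto intro: weight_deriv)

lemma weight_ge_1:
  assumes "t0 \<le> t"
  shows "1 \<le> weight t"
proof -
  have "0 \<le> integral {t0..t} rate"
    using rate_nonneg
    by (intro integral_nonneg continuous_on_atLeast_imp_integrable_on_Icc[OF continuous_rate]) auto
  then show ?thesis by (simp add: weight_def)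
qed

lemma has_integral_rate_weight:
  assumes "t0 \<le> x"
  shows "((\<lambda>t. rate t * weight t) has_integral (weight x - 1) / 2) {t0..x}"
proof -
  have "((\<lambda>t. rate t * weight t) has_integral weight x / 2 - weight t0 / 2) {t0..x}"
  proof (rule fundamental_theorem_of_calculus[OF assms])
    fix t assume "t \<in> {t0..x}"
    then have "((\<lambda>t. weight t / 2) has_real_derivative rate t * weight t) (at t within {t0..})"
      by (auto intro!: derivative_eq_intros weight_deriv)
    then show "((\<lambda>t. weight t / 2) has_vector_derivative rate t * weight t) (at t within {t0..x})"
      by (auto simp flip: has_real_derivative_iff_has_vector_derivative intro: DERIV_subset)
  qed
  then show ?thesis by (simp add: weight_def diff_divide_distrib)
qed

lemma continuous_field_along:
  assumes "continuous_on {t0..} g"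
  shows "continuous_on {t0..} (field_along g)"
  unfolding field_along_def
  by (rule continuous_on_compose2[OF continuous_field, of _ "\<lambda>t. (t, y0 + weight t *\<^sub>R g t)",
        simplified])
    (auto intro!: continuous_intros assms continuous_weight)

lemma field_along_integrable:
  "continuous_on {t0..} g \<Longrightarrow> field_along g integrable_on {t0..x}"
  by (rule continuous_on_atLeast_imp_integrable_on_Icc[OF continuous_field_along]) auto

lemma continuous_picard:
  assumes "continuous_on {t0..} g"
  shows "continuous_on UNIV (picard g)"
proof -
  have "continuous_on {t0..} (\<lambda>x. integral {t0..x} (field_along g))"
    unfolding continuous_on_eq_continuous_within
    by (auto intro!: has_vector_derivative_continuous integral_has_vector_derivative_atLeast
        continuous_field_along assms)
  then have "continuous_on {t0..} (\<lambda>x. (1 / weight x) *\<^sub>R integral {t0..x} (field_along g))"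
    by (intro continuous_intros continuous_weight) (simp add: weight_pos less_imp_neq[symmetric])
  then show ?thesis
    unfolding picard_def
    by (rule continuous_on_compose2[of _ _ UNIV "\<lambda>x. max t0 x"]) (auto intro!: continuous_intros)
qed

lemma norm_weighted_integral_le:
  fixes h :: "real \<Rightarrow> 'a"
  assumes "t0 \<le> x" "0 \<le> c" "h integrable_on {t0..x}"
    and "\<And>t. t \<in> {t0..x} \<Longrightarrow> norm (h t) \<le> c * (rate t * weight t)"
  shows "norm ((1 / weight x) *\<^sub>R integral {t0..x} h) \<le> c / 2"
proof -
  have int: "((\<lambda>t. c * (rate t * weight t)) has_integral c * ((weight x - 1) / 2)) {t0..x}"
    by (intro has_integral_mult_right has_integral_rate_weight assms)
  have "norm (integral {t0..x} h) \<le> integral {t0..x} (\<lambda>t. c * (rate t * weight t))"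
    by (rule integral_norm_bound_integral) (use assms int in \<open>auto simp: integrable_on_def\<close>)
  also have "\<dots> = c * ((weight x - 1) / 2)"
    by (rule integral_unique[OF int])
  also have "\<dots> \<le> c / 2 * weight x"
    using \<open>0 \<le> c\<close> by (simp add: algebra_simps)
  finally show ?thesis
    using weight_pos[of x] by (simp add: field_simps)
qed

lemma norm_picard_le:
  fixes g :: "real \<Rightarrow>\<^sub>C 'a"
  shows "norm (picard g x) \<le> (1 + norm g) / 2"
  unfolding picard_def
proof (rule norm_weighted_integral_le)
  fix t assume t: "t \<in> {t0..max t0 x}"
  then have "t0 \<le> t" by simp
  have "norm (field_along g t) \<le> norm (f t y0) + dist (field_along g t) (f t y0)"
    using dist_triangle2[of "field_along g t" 0 "f t y0"] by (simp add: dist_commute)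
  also have "dist (field_along g t) (f t y0) \<le> L t * dist (y0 + weight t *\<^sub>R g t) y0"
    unfolding field_along_def by (rule lipschitz[OF \<open>t0 \<le> t\<close>])
  also have "\<dots> = L t * (norm (g t) * weight t)"
    using weight_pos[of t] by (simp add: dist_norm mult.commute)
  also have "\<dots> \<le> \<bar>L t\<bar> * (norm g * weight t)"
    using weight_pos[of t] norm_bounded[of g t] by (intro mult_mono) auto
  also have "norm (f t y0) \<le> norm (f t y0) * weight t"
    using mult_left_mono[OF weight_ge_1[OF \<open>t0 \<le> t\<close>], of "norm (f t y0)"] by simp
  finally have "norm (field_along g t) \<le> (norm (f t y0) + norm g * \<bar>L t\<bar>) * weight t"
    by (simp add: algebra_simps)
  also have "\<dots> \<le> ((1 + norm g) * rate t) * weight t"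
    using weight_pos[of t] by (intro mult_right_mono) (auto simp: rate_def algebra_simps)
  finally show "norm (field_along g t) \<le> (1 + norm g) * (rate t * weight t)"
    by (simp add: mult_ac)
qed (auto intro: field_along_integrable add_nonneg_nonneg)

lemma dist_picard_le:
  fixes g h :: "real \<Rightarrow>\<^sub>C 'a"
  shows "dist (picard g x) (picard h x) \<le> dist g h / 2"
proof -
  let ?x = "max t0 x"
  have "norm ((1 / weight ?x) *\<^sub>R integral {t0..?x} (\<lambda>t. field_along g t - field_along h t))
        \<le> dist g h / 2"
  proof (rule norm_weighted_integral_le)
    fix t assume t: "t \<in> {t0..?x}"
    have "norm (field_along g t - field_along h t)
          \<le> L t * dist (y0 + weight t *\<^sub>R g t) (y0 + weight t *\<^sub>R h t)"
      unfolding field_along_def dist_norm[symmetric] by (rule lipschitz) (use t in auto)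
    also have "\<dots> = L t * (dist (g t) (h t) * weight t)"
      using weight_pos[of t] by (simp add: dist_norm mult.commute flip: scaleR_diff_right)
    also have "\<dots> \<le> rate t * (dist g h * weight t)"
      using weight_pos[of t] dist_bounded[of g t h]
      by (intro mult_mono) (auto simp: rate_def intro: order_trans[OF abs_ge_self])
    finally show "norm (field_along g t - field_along h t) \<le> dist g h * (rate t * weight t)"
      by (simp add: mult_ac)
  qed (auto intro!: integrable_diff field_along_integrable)
  then show ?thesis
    by (simp add: picard_def dist_norm integral_diff field_along_integrable flip: scaleR_diff_right)
qed

lemma picard_fixed_point:
  obtains g :: "real \<Rightarrow>\<^sub>C 'a" where "\<And>x. apply_bcontfun g x = picard g x"
proof -
  define T where "T g = Bcontfun (picard g)" for g :: "real \<Rightarrow>\<^sub>C 'a"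
  have T: "apply_bcontfun (T g) = picard g" for g
    unfolding T_def
    by (rule Bcontfun_inverse, rule bcontfun_normI[OF continuous_picard norm_picard_le]) simp
  have "\<exists>!g. T g = g"
  proof (rule banach_fix_type[of "1/2"])
    show "\<forall>g h. dist (T g) (T h) \<le> 1/2 * dist g h"
      using dist_picard_le by (intro allI dist_bound) (simp add: T)
  qed auto
  then show ?thesis
    using T that by metis
qed

theorem global_solution_exists:
  obtains y where "y t0 = y0"
    and "\<And>t. t0 \<le> t \<Longrightarrow> (y has_vector_derivative f t (y t)) (at t within {t0..})"
proof -
  obtain g :: "real \<Rightarrow>\<^sub>C 'a" where g: "\<And>x. apply_bcontfun g x = picard g x"
    using picard_fixed_point by blast
  define y where "y x = y0 + integral {t0..x} (field_along g)" for x
  have y_eq: "y x = y0 + weight x *\<^sub>R g x" if "t0 \<le> x" for x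
    using that weight_pos[of x] by (subst g) (simp add: y_def picard_def max_absorb2)
  show ?thesis
  proof
    show "y t0 = y0" by (simp add: y_def)
    fix t assume "t0 \<le> t"
    then have "(y has_vector_derivative 0 + field_along g t) (at t within {t0..})"
      unfolding y_def
      by (intro derivative_intros integral_has_vector_derivative_atLeast continuous_field_along) auto
    then show "(y has_vector_derivative f t (y t)) (at t within {t0..})"
      by (simp add: field_along_def y_eq[OF \<open>t0 \<le> t\<close>])
  qed
qed

end

subsection \<open>Improper integrals and limits at infinity\<close>

lemma asymp_equiv_sequentially_SucD:
  assumes "(\<lambda>n. f (Suc n)) \<sim>[sequentially] (\<lambda>n. g (Suc n))"
  shows "f \<sim>[sequentially] g"
  using assms unfolding asymp_equiv_def by (subst (asm) filterlim_sequentially_Suc)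

lemma absolutely_integrable_tendsto_integral_atLeast:
  fixes f :: "real \<Rightarrow> 'a::euclidean_space"
  assumes "f absolutely_integrable_on {a..}"
  shows "((\<lambda>b. integral {a..b} f) \<longlongrightarrow> integral {a..} f) at_top"
proof -
  have "((\<lambda>b. set_lebesgue_integral lebesgue {a..b} f)
      \<longlongrightarrow> set_lebesgue_integral lebesgue {a..} f) at_top"
    by (rule tendsto_set_lebesgue_integral_at_top[OF _ assms]) simp
  moreover have "set_lebesgue_integral lebesgue {a..b} f = integral {a..b} f" for b
    by (intro set_lebesgue_integral_eq_integral(2) absolutely_integrable_on_subinterval[OF assms])
      auto
  ultimately show ?thesis
    by (simp add: set_lebesgue_integral_eq_integral(2)[OF assms])
qed

lemma absolutely_integrable_tail_tendsto_0:
  fixes f :: "real \<Rightarrow> 'a::euclidean_space"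
  assumes f: "f absolutely_integrable_on {a..}"
  shows "((\<lambda>c. integral {c..} f) \<longlongrightarrow> 0) at_top"
proof -
  have "((\<lambda>c. integral {a..} f - integral {a..c} f) \<longlongrightarrow> integral {a..} f - integral {a..} f) at_top"
    by (intro tendsto_intros absolutely_integrable_tendsto_integral_atLeast f)
  moreover have "\<forall>\<^sub>F c in at_top. integral {a..} f - integral {a..c} f = integral {c..} f"
    using eventually_ge_at_top[of a]
  proof eventually_elim
    case (elim c)
    have "f integrable_on {a..c}" "f integrable_on {c..}"
      using elim by (auto intro!: set_lebesgue_integral_eq_integral(1) set_integrable_subset[OF f])
    then have "integral ({a..c} \<union> {c..}) f = integral {a..c} f + integral {c..} f"
      using elim by (intro integral_Un) auto
    moreover have "{a..c} \<union> {c..} = {a..}" using elim by auto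
    ultimately show ?case by simp
  qed
  ultimately show ?thesis
    by (auto intro: Lim_transform_eventually)
qed

lemma integral_Icc_le_integral_atLeast:
  fixes f :: "real \<Rightarrow> real"
  assumes "f integrable_on {a..}" "\<And>x. a \<le> x \<Longrightarrow> 0 \<le> f x" "a \<le> c"
  shows "integral {c..b} f \<le> integral {a..} f"
proof (rule integral_subset_le)
  show "f integrable_on {c..b}"
    using integrable_on_subinterval[OF assms(1), of c b] assms(3) by auto
qed (use assms in auto)

lemma nonneg_integrable_on_atLeastI:
  fixes f :: "real \<Rightarrow> real"
  assumes int: "\<And>x. f integrable_on {a..x}" and nonneg: "\<And>x. a \<le> x \<Longrightarrow> 0 \<le> f x"
    and integral_le_B: "\<And>x. a \<le> x \<Longrightarrow> integral {a..x} f \<le> B"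
  shows "f integrable_on {a..}"
proof -
  let ?I = "SUP x\<in>{a..}. integral {a..x} f"
  have bdd: "bdd_above ((\<lambda>x. integral {a..x} f) ` {a..})"
    by (rule bdd_aboveI2[of _ _ B]) (use integral_le_B in auto)
  have "((\<lambda>x. integral {a..x} f) \<longlongrightarrow> ?I) at_top"
  proof (rule increasing_tendsto)
    show "\<forall>\<^sub>F x in at_top. integral {a..x} f \<le> ?I"
      using eventually_ge_at_top[of a] by eventually_elim (auto intro!: cSUP_upper bdd)
    fix l assume "l < ?I"
    then obtain x where "a \<le> x" and x: "l < integral {a..x} f"
      using less_cSUP_iff[OF _ bdd] by auto
    show "\<forall>\<^sub>F y in at_top. l < integral {a..y} f"
      using eventually_ge_at_top[of x]
    proof eventually_elim
      case (elim y)
      then have "integral {a..x} f \<le> integral {a..y} f"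
        by (intro integral_subset_le) (use int nonneg in auto)
      then show ?case using x by simp
    qed
  qed
  then have "(f has_integral ?I) {a..}"
    by (rule has_integral_to_inf[OF int _ nonneg])
  then show ?thesis by blast
qed

lemma frequently_less_of_bounded_integral:
  fixes f :: "real \<Rightarrow> real"
  assumes int: "\<And>x. f integrable_on {a..x}"
    and integral_le_B: "\<And>x. a \<le> x \<Longrightarrow> integral {a..x} f \<le> B" and "0 < e"
  shows "\<exists>\<^sub>F x in at_top. f x < e"
  unfolding frequently_def
proof
  assume "\<forall>\<^sub>F x in at_top. \<not> f x < e"
  then obtain y where y: "\<And>x. y \<le> x \<Longrightarrow> e \<le> f x"
    by (auto simp: eventually_at_top_linorder not_less)
  define z where "z = max a y"
  define x where "x = z + (\<bar>B - integral {a..z} f\<bar> + 1) / e"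
  have z: "a \<le> z" "y \<le> z" "z \<le> x"
    using \<open>0 < e\<close> by (auto simp: z_def x_def)
  have "e * (x - z) = integral {z..x} (\<lambda>_. e)"
    using z by simp
  also have "\<dots> \<le> integral {z..x} f"
    using y z integrable_on_subinterval[OF int, of z x x] by (intro integral_le) auto
  also have "\<dots> = integral {a..x} f - integral {a..z} f"
    by (rule integral_Icc_diff[OF z(1,3) int, symmetric])
  also have "\<dots> \<le> B - integral {a..z} f"
    using integral_le_B[of x] z by simp
  finally have "e * (x - z) \<le> B - integral {a..z} f" .
  moreover have "e * (x - z) = \<bar>B - integral {a..z} f\<bar> + 1"
    using \<open>0 < e\<close> by (simp add: x_def)
  ultimately show False by linarith
qed

subsection \<open>Locally absolutely continuous functions\<close>

lemma absolutely_integrable_on_realD: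
  fixes f :: "real \<Rightarrow> real"
  assumes "f absolutely_integrable_on S"
  shows "f integrable_on S" "(\<lambda>x. \<bar>f x\<bar>) integrable_on S"
  using assms by (auto simp: absolutely_integrable_on_def)

lemma loc_AC_deriv_absolutely_integrable:
  assumes "loc_AC_deriv f g" "0 \<le> a"
  shows "g absolutely_integrable_on {a..b}"
proof (cases "a \<le> b")
  case True
  then have "g absolutely_integrable_on {0..b}"
    using assms by (auto simp: loc_AC_deriv_def)
  then show ?thesis
    by (rule absolutely_integrable_on_subinterval) (use assms in auto)
qed auto

lemma loc_AC_deriv_eq:
  assumes "loc_AC_deriv f g" "0 \<le> x"
  shows "f x = f 0 + integral {0..x} g"
  using assms unfolding loc_AC_deriv_def by blast

lemma loc_AC_deriv_increment:
  assumes "loc_AC_deriv f g" "0 \<le> a" "a \<le> b"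
  shows "f b - f a = integral {a..b} g"
proof -
  have "integral {0..b} g - integral {0..a} g = integral {a..b} g"
    using loc_AC_deriv_absolutely_integrable[OF assms(1) order_refl, of b]
    by (intro integral_Icc_diff assms absolutely_integrable_on_realD)
  then show ?thesis
    using loc_AC_deriv_eq[OF assms(1), of a] loc_AC_deriv_eq[OF assms(1), of b] assms(2,3) by simp
qed

lemma loc_AC_deriv_continuous_on:
  assumes "loc_AC_deriv f g"
  shows "continuous_on {0..} f"
proof -
  have "continuous (at x within {0..}) (\<lambda>x. integral {0..x} g)" if "0 \<le> x" for x
  proof -
    have "continuous_on {0..x+1} (\<lambda>x. integral {0..x} g)"
      by (intro indefinite_integral_continuous_1 absolutely_integrable_on_realD
          loc_AC_deriv_absolutely_integrable[OF assms]) simp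
    then have "continuous (at x within {0..x+1}) (\<lambda>x. integral {0..x} g)"
      using that by (simp add: continuous_on_eq_continuous_within)
    moreover have "at x within {0..x+1} = at x within {0..}"
      by (rule at_within_nhd[of _ "{..<x+1}"]) auto
    ultimately show ?thesis by simp
  qed
  then have "continuous_on {0..} (\<lambda>x. f 0 + integral {0..x} g)"
    by (intro continuous_intros) (simp add: continuous_on_eq_continuous_within)
  then show ?thesis
    by (rule continuous_on_eq) (simp only: atLeast_iff loc_AC_deriv_eq[OF assms, symmetric])
qed

lemma absolutely_integrable_continuous_mult:
  fixes f g :: "real \<Rightarrow> real"
  assumes "continuous_on {a..b} f" "g absolutely_integrable_on {a..b}"
  shows "(\<lambda>x. f x * g x) absolutely_integrable_on {a..b}"
  by (rule absolutely_integrable_bounded_measurable_product_real[OF _ _ _ assms(2)])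
    (auto intro!: continuous_imp_measurable_on_sets_lebesgue assms compact_imp_bounded
       compact_continuous_image)

lemma eq_of_small_increments:
  fixes D :: "real \<Rightarrow> 'a::real_normed_vector" and A :: "real \<Rightarrow> real"
  assumes "a \<le> b"
    and small: "\<And>e x. 0 < e \<Longrightarrow> x \<in> {a..b} \<Longrightarrow> \<exists>d>0. \<forall>s t. a \<le> s \<longrightarrow> s \<le> x \<longrightarrow> x \<le> t \<longrightarrow> t \<le> b \<longrightarrow>
                  t - s < d \<longrightarrow> norm (D t - D s) \<le> e * (A t - A s)"
  shows "D b = D a"
proof -
  have bound: "norm (D b - D a) \<le> e * (A b - A a)" if "0 < e" for e
  proof -
    let ?P = "\<lambda>s t. a \<le> s \<longrightarrow> t \<le> b \<longrightarrow> norm (D t - D s) \<le> e * (A t - A s)"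
    have "?P a b"
    proof (rule Bolzano[where P = ?P, OF \<open>a \<le> b\<close>])
      fix r s t assume steps: "?P r s" "?P s t" and rst: "r \<le> s" "s \<le> t"
      show "?P r t"
      proof (intro impI)
        assume "a \<le> r" "t \<le> b"
        then have "norm (D s - D r) \<le> e * (A s - A r)" "norm (D t - D s) \<le> e * (A t - A s)"
          using steps rst by auto
        then show "norm (D t - D r) \<le> e * (A t - A r)"
          using norm_triangle_ineq[of "D t - D s" "D s - D r"] by (simp add: right_diff_distrib)
      qed
    next
      fix x assume "a \<le> x" "x \<le> b"
      then show "\<exists>d>0. \<forall>s t. s \<le> x \<and> x \<le> t \<and> t - s < d \<longrightarrow> ?P s t"
        using small[OF that, of x] by (meson atLeastAtMost_iff)
    qed
    then show ?thesis by simp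
  qed
  have "((\<lambda>e. e * (A b - A a)) \<longlongrightarrow> 0) (at_right 0)"
    by (auto intro!: tendsto_eq_intros)
  then have "norm (D b - D a) \<le> 0"
    by (rule tendsto_lowerbound) (auto simp: eventually_at_right_field intro!: exI[of _ 1] bound)
  then show ?thesis by simp
qed

lemma loc_AC_deriv_mult_absolutely_integrable:
  assumes f: "loc_AC_deriv f f'" and g: "loc_AC_deriv g g'" and "0 \<le> a"
  shows "(\<lambda>x. f' x * g x + f x * g' x) absolutely_integrable_on {a..b}"
proof -
  have "continuous_on {a..b} f" "continuous_on {a..b} g"
    using f[THEN loc_AC_deriv_continuous_on] g[THEN loc_AC_deriv_continuous_on] \<open>0 \<le> a\<close>
    by (auto elim: continuous_on_subset)
  then have "(\<lambda>x. g x * f' x) absolutely_integrable_on {a..b}"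
    "(\<lambda>x. f x * g' x) absolutely_integrable_on {a..b}"
    using loc_AC_deriv_absolutely_integrable[OF f \<open>0 \<le> a\<close>]
      loc_AC_deriv_absolutely_integrable[OF g \<open>0 \<le> a\<close>]
    by (auto intro: absolutely_integrable_continuous_mult)
  from set_integral_add(1)[OF this] show ?thesis by (simp only: mult.commute)
qed

text \<open>\<open>f b g b - f a g a - \<integral>\<^sub>a\<^sup>b (f' g + f g') = \<integral>\<^sub>a\<^sup>b f' (g b - g) + (f a - f) g'\<close>.\<close>

lemma loc_AC_deriv_mult_increment_error:
  assumes f: "loc_AC_deriv f f'" and g: "loc_AC_deriv g g'" and ab: "0 \<le> a" "a \<le> b"
    and osc: "\<And>t. t \<in> {a..b} \<Longrightarrow> \<bar>f a - f t\<bar> \<le> e" "\<And>t. t \<in> {a..b} \<Longrightarrow> \<bar>g b - g t\<bar> \<le> e"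
  shows "\<bar>f b * g b - f a * g a - integral {a..b} (\<lambda>t. f' t * g t + f t * g' t)\<bar>
    \<le> e * integral {a..b} (\<lambda>t. \<bar>f' t\<bar> + \<bar>g' t\<bar>)"
proof -
  note int_f = absolutely_integrable_on_realD[OF loc_AC_deriv_absolutely_integrable[OF f ab(1)]]
  note int_g = absolutely_integrable_on_realD[OF loc_AC_deriv_absolutely_integrable[OF g ab(1)]]
  note int_h =
    absolutely_integrable_on_realD(1)[OF loc_AC_deriv_mult_absolutely_integrable[OF f g ab(1)]]
  have int_l: "(\<lambda>t. f' t * g b + f a * g' t) integrable_on {a..b}"
    by (intro integrable_add integrable_on_mult_left integrable_on_mult_right int_f int_g)
  have "f b * g b - f a * g a = (f b - f a) * g b + f a * (g b - g a)"
    by (simp add: algebra_simps)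
  also have "\<dots> = integral {a..b} (\<lambda>t. f' t * g b + f a * g' t)"
    using int_f(1) int_g(1)
    by (simp add: integral_add integrable_on_mult_left integrable_on_mult_right
        loc_AC_deriv_increment[OF f ab] loc_AC_deriv_increment[OF g ab])
  finally have "f b * g b - f a * g a - integral {a..b} (\<lambda>t. f' t * g t + f t * g' t)
      = integral {a..b} (\<lambda>t. (f' t * g b + f a * g' t) - (f' t * g t + f t * g' t))"
    by (simp add: integral_diff[OF int_l int_h])
  also have "norm \<dots> \<le> integral {a..b} (\<lambda>t. e * (\<bar>f' t\<bar> + \<bar>g' t\<bar>))"
  proof (rule integral_norm_bound_integral)
    fix t assume t: "t \<in> {a..b}"
    have "\<bar>f' t * (g b - g t)\<bar> \<le> \<bar>f' t\<bar> * e" "\<bar>(f a - f t) * g' t\<bar> \<le> e * \<bar>g' t\<bar>"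
      unfolding abs_mult using osc[OF t] by (auto intro: mult_left_mono mult_right_mono)
    moreover have "(f' t * g b + f a * g' t) - (f' t * g t + f t * g' t)
        = f' t * (g b - g t) + (f a - f t) * g' t"
      by (simp add: algebra_simps)
    ultimately show "norm ((f' t * g b + f a * g' t) - (f' t * g t + f t * g' t))
          \<le> e * (\<bar>f' t\<bar> + \<bar>g' t\<bar>)"
      unfolding real_norm_def by (simp add: distrib_left mult.commute)
  qed (intro integrable_diff integrable_on_mult_right integrable_add int_l int_h int_f int_g)+
  finally show ?thesis by simp
qed

lemma continuous_on_small_oscillation:
  fixes f :: "'a::metric_space \<Rightarrow> 'b::metric_space"
  assumes "continuous_on S f" "x \<in> S" "0 < e"
  obtains d where "0 < d"
    and "\<And>s t. s \<in> S \<Longrightarrow> t \<in> S \<Longrightarrow> dist s x < d \<Longrightarrow> dist t x < d \<Longrightarrow> dist (f s) (f t) < e"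
proof -
  obtain d where "0 < d" and d: "\<And>t. t \<in> S \<Longrightarrow> dist t x < d \<Longrightarrow> dist (f t) (f x) < e / 2"
    using assms(1)[unfolded continuous_on_iff, rule_format, OF assms(2), of "e / 2"] \<open>0 < e\<close> by auto
  show ?thesis
    by (rule that[OF \<open>0 < d\<close>]) (use d in \<open>blast intro: dist_triangle_half_l\<close>)
qed

lemma loc_AC_deriv_mult:
  assumes f: "loc_AC_deriv f f'" and g: "loc_AC_deriv g g'"
  shows "loc_AC_deriv (\<lambda>x. f x * g x) (\<lambda>x. f' x * g x + f x * g' x)"
  unfolding loc_AC_deriv_def
proof (intro allI impI conjI loc_AC_deriv_mult_absolutely_integrable[OF f g] order_refl)
  fix X :: real assume "0 \<le> X"
  let ?h = "\<lambda>x. f' x * g x + f x * g' x" and ?a = "\<lambda>x. \<bar>f' x\<bar> + \<bar>g' x\<bar>"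
  have int_a: "?a integrable_on {0..t}" and int_h: "?h integrable_on {0..t}" for t
    by (intro integrable_add absolutely_integrable_on_realD order_refl
        loc_AC_deriv_absolutely_integrable[OF f] loc_AC_deriv_absolutely_integrable[OF g]
        loc_AC_deriv_mult_absolutely_integrable[OF f g])+
  define A where "A x = integral {0..x} ?a" for x
  define D where "D x = f x * g x - integral {0..x} ?h" for x
  have "D X = D 0"
  proof (rule eq_of_small_increments[OF \<open>0 \<le> X\<close>])
    fix e x :: real assume "0 < e" "x \<in> {0..X}"
    then have "x \<in> {0..}" by simp
    then obtain d where "0 < d" and d: "\<And>s t. s \<in> {0..} \<Longrightarrow> t \<in> {0..} \<Longrightarrow>
        dist s x < d \<Longrightarrow> dist t x < d \<Longrightarrow> dist (f s, g s) (f t, g t) < e"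
      using continuous_on_small_oscillation[OF continuous_on_Pair _ \<open>0 < e\<close>]
        loc_AC_deriv_continuous_on[OF f] loc_AC_deriv_continuous_on[OF g] by blast
    have "norm (D t - D s) \<le> e * (A t - A s)"
      if st: "0 \<le> s" "s \<le> x" "x \<le> t" "t - s < d" for s t
    proof -
      have near: "dist (f r', g r') (f r, g r) < e" if "r \<in> {s..t}" "r' \<in> {s..t}" for r r'
        using that st by (intro d) (auto simp: dist_real_def)
      have "\<bar>f s - f r\<bar> \<le> e" "\<bar>g t - g r\<bar> \<le> e" if "r \<in> {s..t}" for r
        using near[OF that, of s] near[OF that, of t] st
          dist_fst_le[of "(f s, g s)" "(f r, g r)"] dist_snd_le[of "(f t, g t)" "(f r, g r)"]
        by (auto simp: dist_real_def)
      then have "\<bar>f t * g t - f s * g s - integral {s..t} ?h\<bar> \<le> e * integral {s..t} ?a"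
        using st by (intro loc_AC_deriv_mult_increment_error[OF f g]) simp_all
      then show ?thesis
        using st integral_Icc_diff[OF _ _ int_a, of s t] integral_Icc_diff[OF _ _ int_h, of s t]
        by (simp add: A_def D_def algebra_simps)
    qed
    then show "\<exists>d>0. \<forall>s t. 0 \<le> s \<longrightarrow> s \<le> x \<longrightarrow> x \<le> t \<longrightarrow> t \<le> X \<longrightarrow> t - s < d \<longrightarrow>
        norm (D t - D s) \<le> e * (A t - A s)"
      using \<open>0 < d\<close> by blast
  qed
  then show "f X * g X = f 0 * g 0 + integral {0..X} ?h"
    by (simp add: D_def)
qed

lemma loc_AC_deriv_add:
  assumes f: "loc_AC_deriv f f'" and g: "loc_AC_deriv g g'"
  shows "loc_AC_deriv (\<lambda>x. f x + g x) (\<lambda>x. f' x + g' x)"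
  unfolding loc_AC_deriv_def
proof (intro allI impI conjI)
  fix x :: real assume x: "0 \<le> x"
  note int = f[THEN loc_AC_deriv_absolutely_integrable, OF order_refl]
    g[THEN loc_AC_deriv_absolutely_integrable, OF order_refl]
  show "(\<lambda>x. f' x + g' x) absolutely_integrable_on {0..x}"
    by (rule set_integral_add(1)[OF int])
  show "f x + g x = f 0 + g 0 + integral {0..x} (\<lambda>x. f' x + g' x)"
    using loc_AC_deriv_eq[OF f x] loc_AC_deriv_eq[OF g x]
    by (simp add: integral_add absolutely_integrable_on_realD int)
qed

lemma loc_AC_deriv_cong_AE:
  assumes f: "loc_AC_deriv f g" and ae: "AE x in lebesgue. 0 \<le> x \<longrightarrow> g x = h x"
  shows "loc_AC_deriv f h"
proof -
  obtain N where N: "negligible N" "\<And>x. x \<notin> N \<Longrightarrow> 0 \<le> x \<Longrightarrow> g x = h x"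
    using ae unfolding eventually_ae_filter_negligible by blast
  have "h absolutely_integrable_on {0..x}" "integral {0..x} g = integral {0..x} h" if "0 \<le> x" for x
  proof -
    show "h absolutely_integrable_on {0..x}"
      by (rule absolutely_integrable_spike[OF
            loc_AC_deriv_absolutely_integrable[OF f order_refl] N(1)])
        (use N(2) in force)
    show "integral {0..x} g = integral {0..x} h"
      by (rule integral_spike[OF N(1)]) (use N(2) in force)
  qed
  then show ?thesis
    unfolding loc_AC_deriv_def using loc_AC_deriv_eq[OF f] by metis
qed

lemma loc_AC_deriv_of_C1:
  assumes der: "\<And>x. 0 \<le> x \<Longrightarrow> (f has_real_derivative g x) (at x within {0..})"
    and cont: "continuous_on {0..} g"
  shows "loc_AC_deriv f g"
  unfolding loc_AC_deriv_def
proof (intro allI impI conjI)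
  fix x :: real assume x: "0 \<le> x"
  show "g absolutely_integrable_on {0..x}"
    by (rule absolutely_integrable_continuous_real) (use cont in \<open>auto intro: continuous_on_subset\<close>)
  have "(g has_integral f x - f 0) {0..x}"
  proof (rule fundamental_theorem_of_calculus[OF x])
    fix t assume "t \<in> {0..x}"
    then have "(f has_real_derivative g t) (at t within {0..x})"
      using DERIV_subset[OF der[of t]] by auto
    then show "(f has_vector_derivative g t) (at t within {0..x})"
      by (simp flip: has_real_derivative_iff_has_vector_derivative)
  qed
  then show "f x = f 0 + integral {0..x} g" by (simp add: integral_unique)
qed

lemma loc_AC_deriv_has_real_derivative:
  assumes f: "loc_AC_deriv f g" and cont: "continuous_on {0..} g" and x: "0 \<le> x"
  shows "(f has_real_derivative g x) (at x within {0..})"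
proof (rule has_field_derivative_transform_within[where f="\<lambda>x. f 0 + integral {0..x} g" and d=1])
  show "((\<lambda>x. f 0 + integral {0..x} g) has_real_derivative g x) (at x within {0..})"
    using integral_has_vector_derivative_atLeast[OF cont x]
    by (auto intro!: derivative_eq_intros simp: has_real_derivative_iff_has_vector_derivative)
  show "f 0 + integral {0..y} g = f y" if "y \<in> {0..}" for y
    using loc_AC_deriv_eq[OF f, of y] that by simp
qed (use x in auto)

subsection \<open>Elementary inequalities and trigonometry\<close>

lemma abs_power2_diff_le:
  fixes a b :: real
  assumes "\<bar>a\<bar> \<le> B" "\<bar>b\<bar> \<le> B" "\<bar>a - b\<bar> \<le> d"
  shows "\<bar>a\<^sup>2 - b\<^sup>2\<bar> \<le> 2 * B * d"
proof -
  have "\<bar>a\<^sup>2 - b\<^sup>2\<bar> = \<bar>a + b\<bar> * \<bar>a - b\<bar>"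
    by (simp add: power2_eq_square square_diff_square_factored abs_mult)
  also have "\<dots> \<le> (2 * B) * d"
    using assms by (intro mult_mono) auto
  finally show ?thesis .
qed

lemma linear_system_sum_squares_deriv_le:
  fixes U V w p :: real
  assumes "\<bar>w\<bar> \<le> K" "\<bar>p\<bar> \<le> P"
  shows "2 * U * (w * U + V) + 2 * V * (p * U - w * V) \<le> (2 * K + 1 + P) * (U\<^sup>2 + V\<^sup>2)"
proof -
  have "\<bar>2 * w * (U\<^sup>2 - V\<^sup>2)\<bar> \<le> 2 * K * (U\<^sup>2 + V\<^sup>2)"
    unfolding abs_mult using assms by (intro mult_mono) (auto simp: abs_le_iff)
  moreover have "\<bar>(1 + p) * (2 * U * V)\<bar> \<le> (1 + P) * (U\<^sup>2 + V\<^sup>2)"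
    unfolding abs_mult[of "1 + p"]
  proof (intro mult_mono)
    show "\<bar>2 * U * V\<bar> \<le> U\<^sup>2 + V\<^sup>2"
      using sum_squares_bound[of U V] sum_squares_bound[of U "- V"] by (simp add: abs_le_iff)
  qed (use assms in auto)
  moreover have "2 * U * (w * U + V) + 2 * V * (p * U - w * V)
      = 2 * w * (U\<^sup>2 - V\<^sup>2) + (1 + p) * (2 * U * V)"
    by (simp add: power2_eq_square algebra_simps)
  ultimately show ?thesis
    by (simp add: distrib_right abs_le_iff)
qed

lemma abs_sin_diff_le: "\<bar>sin x - sin y\<bar> \<le> \<bar>x - y\<bar>" for x y :: real
  using field_differentiable_bound[of UNIV sin cos 1 x y] by (auto intro: DERIV_sin)

lemma abs_cos_diff_le: "\<bar>cos x - cos y\<bar> \<le> \<bar>x - y\<bar>" for x y :: real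
  using abs_sin_diff_le[of "x + pi/2" "y + pi/2"] by (simp add: sin_add)

lemma sin_times_cos_add_nat_pi:
  "sin (z + real n * pi) * cos (z + real n * pi) = sin z * cos z"
proof -
  have "sin (z + real n * pi) * cos (z + real n * pi) = sin z * cos z * ((- 1) ^ n * (- 1) ^ n)"
    by (simp add: sin_add cos_add)
  also have "(- 1 :: real) ^ n * (- 1) ^ n = 1"
    by (simp flip: power_mult_distrib)
  finally show ?thesis by simp
qed

lemma sin_times_cos_nonneg:
  "real m * pi \<le> y \<Longrightarrow> y \<le> (real m + 1/2) * pi \<Longrightarrow> 0 \<le> sin y * cos y"
  using sin_times_cos_add_nat_pi[of "y - real m * pi" m]
    mult_nonneg_nonneg[OF sin_ge_zero[of "y - real m * pi"] cos_ge_zero[of "y - real m * pi"]]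
  by (simp add: algebra_simps)

lemma sin_times_cos_nonpos:
  "(real m + 1/2) * pi \<le> y \<Longrightarrow> y \<le> (real m + 1) * pi \<Longrightarrow> sin y * cos y \<le> 0"
  using sin_times_cos_nonneg[of m "y - pi/2"]
  by (simp add: algebra_simps sin_diff cos_diff)

lemma sin_times_sin_pos:
  assumes "real m * pi < y" "y < (real m + 1) * pi" "real m * pi < z" "z < (real m + 1) * pi"
  shows "0 < sin y * sin z"
proof -
  have "0 < sin (y - real m * pi) * sin (z - real m * pi)"
    using assms by (intro mult_pos_pos sin_gt_zero) (auto simp: algebra_simps)
  also have "\<dots> = sin y * sin z * ((- 1) ^ m * (- 1) ^ m)" by (simp add: sin_diff)
  also have "(- 1 :: real) ^ m * (- 1) ^ m = 1" by (simp flip: power_mult_distrib)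
  finally show ?thesis by simp
qed

text \<open>The polar angle of \<open>(cos y, s sin y)\<close> on the branch through \<open>y\<close>, so that
  \<open>tan (scaled_angle s y) = s tan y\<close>.\<close>

definition scaled_angle :: "real \<Rightarrow> real \<Rightarrow> real" where
  "scaled_angle s y = y + arctan ((s - 1) * (sin y * cos y) / ((cos y)\<^sup>2 + s * (sin y)\<^sup>2))"

lemma scaled_angle_1 [simp]: "scaled_angle 1 y = y"
  and scaled_angle_half_pi [simp]: "scaled_angle s (pi / 2) = pi / 2"
  by (simp_all add: scaled_angle_def)

lemma DERIV_arctan_divide:
  fixes N D :: "real \<Rightarrow> real"
  assumes N: "(N has_real_derivative N') (at x within A)"
    and D: "(D has_real_derivative D') (at x within A)" and "D x \<noteq> 0"
  shows "((\<lambda>x. arctan (N x / D x)) has_real_derivative (N' * D x - N x * D') / ((D x)\<^sup>2 + (N x)\<^sup>2))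
    (at x within A)"
proof -
  have pos: "0 < (D x)\<^sup>2" "0 < (D x)\<^sup>2 + (N x)\<^sup>2"
    using \<open>D x \<noteq> 0\<close> by (simp_all add: add_pos_nonneg)
  have "1 + (N x / D x)\<^sup>2 = ((D x)\<^sup>2 + (N x)\<^sup>2) / (D x)\<^sup>2"
    using \<open>D x \<noteq> 0\<close> by (simp add: field_simps)
  then have "inverse (1 + (N x / D x)\<^sup>2) * ((N' * D x - N x * D') / (D x * D x))
      = (N' * D x - N x * D') / ((D x)\<^sup>2 + (N x)\<^sup>2)"
    using pos \<open>D x \<noteq> 0\<close> by (simp add: power2_eq_square)
  then show ?thesis
    using DERIV_chain2[OF DERIV_arctan DERIV_divide[OF N D \<open>D x \<noteq> 0\<close>]] by simp
qed

lemma scaled_angle_deriv: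
  fixes y s :: "real \<Rightarrow> real"
  assumes y: "(y has_real_derivative y') (at x within A)"
    and s: "(s has_real_derivative s') (at x within A)" and "0 < s x"
  shows "((\<lambda>x. scaled_angle (s x) (y x)) has_real_derivative
    (s x * y' + sin (y x) * cos (y x) * s') / ((cos (y x))\<^sup>2 + (s x)\<^sup>2 * (sin (y x))\<^sup>2))
    (at x within A)"
proof -
  define S C where "S = sin (y x)" and "C = cos (y x)"
  define D N where "D = C\<^sup>2 + s x * S\<^sup>2" and "N = (s x - 1) * (S * C)"
  define N' D' where "N' = s' * (S * C) + (s x - 1) * (C * y' * C + S * (- S * y'))"
    and "D' = 2 * C * (- S * y') + (s' * S\<^sup>2 + s x * (2 * S * (C * y')))"
  have sin_cos_squared: "S\<^sup>2 + C\<^sup>2 = 1" by (simp add: S_def C_def)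
  have "0 < D"
  proof (cases "S = 0")
    case False
    then show ?thesis using \<open>0 < s x\<close> by (simp add: D_def add_nonneg_pos)
  qed (use sin_cos_squared in \<open>simp add: D_def\<close>)
  have denominator: "D\<^sup>2 + N\<^sup>2 = C\<^sup>2 + (s x)\<^sup>2 * S\<^sup>2"
    using sin_cos_squared unfolding D_def N_def by algebra
  have numerator: "y' * (D\<^sup>2 + N\<^sup>2) + (N' * D - N * D') = s x * y' + S * C * s'"
    using sin_cos_squared unfolding denominator D_def N_def N'_def D'_def by algebra
  have sin: "((\<lambda>x. sin (y x)) has_real_derivative C * y') (at x within A)"
    and cos: "((\<lambda>x. cos (y x)) has_real_derivative - S * y') (at x within A)"
    using DERIV_chain2[OF DERIV_sin y] DERIV_chain2[OF DERIV_cos y] by (simp_all add: S_def C_def)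
  have N_deriv: "((\<lambda>x. (s x - 1) * (sin (y x) * cos (y x))) has_real_derivative N') (at x within A)"
    by (rule derivative_eq_intros sin cos s refl)+ (simp add: N'_def S_def C_def algebra_simps)
  have D_deriv: "((\<lambda>x. (cos (y x))\<^sup>2 + s x * (sin (y x))\<^sup>2) has_real_derivative D') (at x within A)"
    by (rule derivative_eq_intros sin cos s refl)+ (simp add: D'_def S_def C_def algebra_simps)
  have "((\<lambda>x. scaled_angle (s x) (y x)) has_real_derivative
      y' + (N' * D - N * D') / (D\<^sup>2 + N\<^sup>2)) (at x within A)"
    unfolding scaled_angle_def using DERIV_add[OF y DERIV_arctan_divide[OF N_deriv D_deriv]] \<open>0 < D\<close>
    by (simp add: D_def N_def S_def C_def)
  moreover have "y' + (N' * D - N * D') / (D\<^sup>2 + N\<^sup>2) = (s x * y' + S * C * s') / (D\<^sup>2 + N\<^sup>2)"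
    using numerator \<open>0 < D\<close> by (simp add: field_simps add_pos_nonneg)
  ultimately show ?thesis
    by (simp add: denominator S_def C_def)
qed

lemma scaled_angle_speed_bound:
  fixes S C w s s' K :: real
  assumes SC: "S\<^sup>2 + C\<^sup>2 = 1" and "1 \<le> s" "\<bar>w\<bar> \<le> K" "\<bar>s'\<bar> \<le> 1"
  shows "\<bar>(s * ((C + w * S)\<^sup>2 + s\<^sup>2 * S\<^sup>2) + S * C * s') / (C\<^sup>2 + s\<^sup>2 * S\<^sup>2) - s\<bar> \<le> K + K\<^sup>2 + 1"
proof -
  define D where "D = C\<^sup>2 + s\<^sup>2 * S\<^sup>2"
  have s_le: "s \<le> s\<^sup>2" "1 \<le> s\<^sup>2"
    using \<open>1 \<le> s\<close> by (simp_all add: self_le_power one_le_power)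
  have "1 * S\<^sup>2 \<le> s\<^sup>2 * S\<^sup>2" "s * S\<^sup>2 \<le> s\<^sup>2 * S\<^sup>2"
    using s_le by (intro mult_right_mono; simp)+
  then have D_ge: "1 \<le> D" "s * S\<^sup>2 \<le> D"
    using SC zero_le_power2[of C] unfolding D_def by linarith+
  have sSC: "2 * \<bar>s * (S * C)\<bar> \<le> D"
    using sum_squares_bound[of C "s * S"] sum_squares_bound[of C "- s * S"]
    by (auto simp: D_def power_mult_distrib abs_if algebra_simps)
  have "\<bar>S * C\<bar> \<le> s * \<bar>S * C\<bar>"
    using mult_right_mono[OF \<open>1 \<le> s\<close>, of "\<bar>S * C\<bar>"] by simp
  also have "\<dots> = \<bar>s * (S * C)\<bar>"
    using \<open>1 \<le> s\<close> by (simp add: abs_mult)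
  also have "\<dots> \<le> D"
    using sSC by linarith
  finally have "\<bar>s' * (S * C)\<bar> \<le> 1 * D"
    unfolding abs_mult[of s'] using assms(4) by (intro mult_mono) auto
  moreover have "\<bar>w * (2 * (s * (S * C)))\<bar> \<le> K * D"
    unfolding abs_mult[of w] using sSC assms(3) by (intro mult_mono) auto
  moreover have "\<bar>w\<^sup>2 * (s * S\<^sup>2)\<bar> \<le> K\<^sup>2 * D"
    unfolding abs_mult[of "w\<^sup>2"] using D_ge(2) assms(2,3)
    by (intro mult_mono) (auto simp: power2_le_iff_abs_le)
  ultimately have "\<bar>w * (2 * (s * (S * C))) + w\<^sup>2 * (s * S\<^sup>2) + s' * (S * C)\<bar> \<le> (K + K\<^sup>2 + 1) * D"
    unfolding distrib_right by linarith
  moreover have "(s * ((C + w * S)\<^sup>2 + s\<^sup>2 * S\<^sup>2) + S * C * s') / D - s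
      = (w * (2 * (s * (S * C))) + w\<^sup>2 * (s * S\<^sup>2) + s' * (S * C)) / D"
    using D_ge(1) by (simp add: field_simps D_def power2_eq_square)
  ultimately show ?thesis
    using D_ge(1) by (simp add: abs_divide pos_divide_le_eq flip: D_def)
qed

subsection \<open>The quasi-derivative system\<close>

locale airy_potential =
  fixes q :: "real \<Rightarrow> real"
  assumes q_absolutely_integrable: "q absolutely_integrable_on {0..}"
begin

definition q_tail :: "real \<Rightarrow> real" where
  "q_tail c = integral {c..} (\<lambda>x. \<bar>q x\<bar>)"

abbreviation q_norm :: real where
  "q_norm \<equiv> q_tail 0"

definition Q :: "real \<Rightarrow> real" where
  "Q x = integral {0..x} q"

definition quasi_potential :: "real \<Rightarrow> real \<Rightarrow> real" where
  "quasi_potential lam x = x - lam - (Q x)\<^sup>2"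

text \<open>\<open>U'' = (x + q - lam) U\<close> as a system with continuous coefficients for \<open>U\<close> and \<open>V = U' - Q U\<close>.\<close>

definition quasi_solution :: "real \<Rightarrow> (real \<Rightarrow> real) \<Rightarrow> (real \<Rightarrow> real) \<Rightarrow> bool" where
  "quasi_solution lam U V \<longleftrightarrow> (\<forall>x\<ge>0.
     (U has_real_derivative Q x * U x + V x) (at x within {0..}) \<and>
     (V has_real_derivative quasi_potential lam x * U x - Q x * V x) (at x within {0..}))"

lemma abs_q_absolutely_integrable: "0 \<le> c \<Longrightarrow> (\<lambda>x. \<bar>q x\<bar>) absolutely_integrable_on {c..}"
  using absolutely_integrable_abs[OF set_integrable_subset[OF q_absolutely_integrable, of "{c..}"]]
  by simp

lemma q_absolutely_integrable_Icc: "0 \<le> a \<Longrightarrow> q absolutely_integrable_on {a..b}"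
  using absolutely_integrable_on_subinterval[OF q_absolutely_integrable, of a b] by auto

lemma integral_abs_q_le_tail:
  assumes "0 \<le> c" "c \<le> a"
  shows "integral {a..b} (\<lambda>x. \<bar>q x\<bar>) \<le> q_tail c"
  unfolding q_tail_def
  by (rule integral_Icc_le_integral_atLeast)
    (use assms abs_q_absolutely_integrable absolutely_integrable_on_realD(1) in auto)

lemma q_norm_nonneg: "0 \<le> q_norm"
  using integral_abs_q_le_tail[of 0 0 0] by simp

lemma q_tail_tendsto_0: "(q_tail \<longlongrightarrow> 0) at_top"
  using absolutely_integrable_tail_tendsto_0[OF abs_q_absolutely_integrable[OF order_refl]]
  by (simp add: q_tail_def[abs_def])

lemma loc_AC_deriv_Q: "loc_AC_deriv Q q"
  unfolding loc_AC_deriv_def Q_def using q_absolutely_integrable_Icc by auto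

lemma Q_0 [simp]: "Q 0 = 0"
  by (simp add: Q_def)

lemma continuous_Q: "continuous_on {0..} Q"
  by (rule loc_AC_deriv_continuous_on[OF loc_AC_deriv_Q])

lemma continuous_quasi_potential: "continuous_on {0..} (quasi_potential lam)"
  unfolding quasi_potential_def by (intro continuous_intros continuous_Q)

lemma abs_Q_le:
  assumes "0 \<le> x"
  shows "\<bar>Q x\<bar> \<le> q_norm"
proof -
  have "norm (integral {0..x} q) \<le> integral {0..x} (\<lambda>x. \<bar>q x\<bar>)"
    by (rule integral_norm_bound_integral)
      (use absolutely_integrable_on_realD[OF q_absolutely_integrable_Icc[of 0 x]] in auto)
  then show ?thesis
    using integral_abs_q_le_tail[of 0 0 x] by (simp add: Q_def)
qed

lemma Q_power2_le: "0 \<le> x \<Longrightarrow> (Q x)\<^sup>2 \<le> q_norm\<^sup>2"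
  using abs_Q_le[of x] q_norm_nonneg by (simp add: abs_le_square_iff[symmetric])

lemma quasi_solutionD:
  assumes "quasi_solution lam U V" "0 \<le> x"
  shows "(U has_real_derivative Q x * U x + V x) (at x within {0..})"
    and "(V has_real_derivative quasi_potential lam x * U x - Q x * V x) (at x within {0..})"
  using assms by (auto simp: quasi_solution_def)

lemma quasi_solution_diff_scaled:
  assumes "quasi_solution lam U V" "quasi_solution lam U' V'"
  shows "quasi_solution lam (\<lambda>x. U x - c * U' x) (\<lambda>x. V x - c * V' x)"
  unfolding quasi_solution_def
proof (intro allI impI conjI)
  fix x :: real assume x: "0 \<le> x"
  note deriv = quasi_solutionD[OF assms(1) x] quasi_solutionD[OF assms(2) x]
  show "((\<lambda>x. U x - c * U' x) has_real_derivative
      Q x * (U x - c * U' x) + (V x - c * V' x)) (at x within {0..})"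
    by (rule DERIV_cong[OF DERIV_diff[OF deriv(1) DERIV_cmult[OF deriv(3)]]])
      (simp add: algebra_simps)
  show "((\<lambda>x. V x - c * V' x) has_real_derivative
      quasi_potential lam x * (U x - c * U' x) - Q x * (V x - c * V' x)) (at x within {0..})"
    by (rule DERIV_cong[OF DERIV_diff[OF deriv(2) DERIV_cmult[OF deriv(4)]]])
      (simp add: algebra_simps)
qed

lemma quasi_solution_wronskian_deriv:
  assumes "quasi_solution lam U V" "quasi_solution lam' U' V'" "0 \<le> x"
  shows "((\<lambda>x. U' x * V x - U x * V' x) has_real_derivative (lam' - lam) * (U x * U' x))
    (at x within {0..})"
  by (rule DERIV_cong[OF DERIV_diff[OF DERIV_mult[OF quasi_solutionD(1)[OF assms(2,3)]
          quasi_solutionD(2)[OF assms(1,3)]] DERIV_mult[OF quasi_solutionD(1)[OF assms(1,3)]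
          quasi_solutionD(2)[OF assms(2,3)]]]])
    (simp add: quasi_potential_def algebra_simps)

lemma quasi_solution_sum_squares_growth:
  assumes sol: "quasi_solution lam U V" and ab: "0 \<le> a" "a \<le> b"
    and potential_le: "\<And>x. x \<in> {a..b} \<Longrightarrow> \<bar>quasi_potential lam x\<bar> \<le> P"
  shows "(U b)\<^sup>2 + (V b)\<^sup>2 \<le> ((U a)\<^sup>2 + (V a)\<^sup>2) * exp ((2 * q_norm + 1 + P) * (b - a))"
proof (rule gronwall_within[OF ab(2), of "{0..}"])
  show "((\<lambda>x. (U x)\<^sup>2 + (V x)\<^sup>2) has_real_derivative
      2 * U x * (Q x * U x + V x) + 2 * V x * (quasi_potential lam x * U x - Q x * V x))
      (at x within {0..})" if "x \<in> {a..b}" for x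
    using that ab by (auto intro!: derivative_eq_intros quasi_solutionD[OF sol])
  show "2 * U x * (Q x * U x + V x) + 2 * V x * (quasi_potential lam x * U x - Q x * V x)
      \<le> (2 * q_norm + 1 + P) * ((U x)\<^sup>2 + (V x)\<^sup>2)" if "x \<in> {a<..<b}" for x
    by (rule linear_system_sum_squares_deriv_le) (use that ab abs_Q_le potential_le in auto)
qed (use ab in auto)

lemma quasi_solution_zero:
  assumes sol: "quasi_solution lam U V" and init: "U 0 = 0" "V 0 = 0" and "0 \<le> b"
  shows "U b = 0"
proof -
  have "compact (quasi_potential lam ` {0..b})"
    by (intro compact_continuous_image continuous_on_subset[OF continuous_quasi_potential]) auto
  then obtain P where "\<And>x. x \<in> {0..b} \<Longrightarrow> \<bar>quasi_potential lam x\<bar> \<le> P"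
    using compact_imp_bounded bounded_iff by (metis imageI real_norm_def)
  from quasi_solution_sum_squares_growth[OF sol order_refl \<open>0 \<le> b\<close> this]
  show ?thesis by (simp add: init sum_power2_le_zero_iff)
qed

subsection \<open>Pruefer angle and the regular solution\<close>

definition prufer_rhs :: "real \<Rightarrow> real \<Rightarrow> real \<Rightarrow> real" where
  "prufer_rhs lam x y = (cos y + Q x * sin y)\<^sup>2 + (lam - x) * (sin y)\<^sup>2"

definition prufer_lipschitz :: "real \<Rightarrow> real \<Rightarrow> real" where
  "prufer_lipschitz lam x = 2 * (1 + q_norm)\<^sup>2 + 2 * (\<bar>lam\<bar> + x)"

lemma abs_cos_add_Q_sin_le:
  assumes "0 \<le> x"
  shows "\<bar>cos y + Q x * sin y\<bar> \<le> 1 + q_norm"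
proof -
  have "\<bar>Q x * sin y\<bar> \<le> q_norm * 1"
    unfolding abs_mult using abs_Q_le[OF assms] q_norm_nonneg by (intro mult_mono) auto
  then show ?thesis using abs_cos_le_one[of y] by linarith
qed

lemma prufer_rhs_lipschitz:
  assumes "0 \<le> x"
  shows "\<bar>prufer_rhs lam x y - prufer_rhs lam x z\<bar> \<le> prufer_lipschitz lam x * \<bar>y - z\<bar>"
proof -
  let ?A = "\<lambda>y. cos y + Q x * sin y"
  have "\<bar>Q x * (sin y - sin z)\<bar> \<le> q_norm * \<bar>y - z\<bar>"
    unfolding abs_mult using abs_Q_le[OF assms] q_norm_nonneg abs_sin_diff_le
    by (intro mult_mono) auto
  then have "\<bar>?A y - ?A z\<bar> \<le> (1 + q_norm) * \<bar>y - z\<bar>"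
    using abs_cos_diff_le[of y z] by (simp add: algebra_simps)
  then have "\<bar>(?A y)\<^sup>2 - (?A z)\<^sup>2\<bar> \<le> 2 * (1 + q_norm) * ((1 + q_norm) * \<bar>y - z\<bar>)"
    by (intro abs_power2_diff_le abs_cos_add_Q_sin_le assms)
  moreover have "\<bar>(sin y)\<^sup>2 - (sin z)\<^sup>2\<bar> \<le> 2 * 1 * \<bar>y - z\<bar>"
    by (intro abs_power2_diff_le abs_sin_diff_le) auto
  then have "\<bar>lam - x\<bar> * \<bar>(sin y)\<^sup>2 - (sin z)\<^sup>2\<bar> \<le> (\<bar>lam\<bar> + x) * (2 * \<bar>y - z\<bar>)"
    using assms by (intro mult_mono) auto
  then have "\<bar>(lam - x) * (sin y)\<^sup>2 - (lam - x) * (sin z)\<^sup>2\<bar> \<le> (\<bar>lam\<bar> + x) * (2 * \<bar>y - z\<bar>)"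
    by (simp add: abs_mult flip: right_diff_distrib)
  ultimately have "\<bar>((?A y)\<^sup>2 - (?A z)\<^sup>2) + ((lam - x) * (sin y)\<^sup>2 - (lam - x) * (sin z)\<^sup>2)\<bar>
      \<le> 2 * (1 + q_norm) * ((1 + q_norm) * \<bar>y - z\<bar>) + (\<bar>lam\<bar> + x) * (2 * \<bar>y - z\<bar>)"
    by (rule order_trans[OF abs_triangle_ineq add_mono])
  moreover have "prufer_rhs lam x y - prufer_rhs lam x z
      = ((?A y)\<^sup>2 - (?A z)\<^sup>2) + ((lam - x) * (sin y)\<^sup>2 - (lam - x) * (sin z)\<^sup>2)"
    by (simp add: prufer_rhs_def)
  ultimately have "\<bar>prufer_rhs lam x y - prufer_rhs lam x z\<bar>
      \<le> 2 * (1 + q_norm) * ((1 + q_norm) * \<bar>y - z\<bar>) + (\<bar>lam\<bar> + x) * (2 * \<bar>y - z\<bar>)"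
    by (simp only:)
  also have "\<dots> = prufer_lipschitz lam x * \<bar>y - z\<bar>"
    unfolding prufer_lipschitz_def by algebra
  finally show ?thesis .
qed

lemma abs_prufer_rhs_le:
  assumes "0 \<le> x"
  shows "\<bar>prufer_rhs lam x y\<bar> \<le> (1 + q_norm)\<^sup>2 + \<bar>lam - x\<bar>"
proof -
  have "\<bar>(cos y + Q x * sin y)\<^sup>2\<bar> \<le> (1 + q_norm)\<^sup>2"
    using abs_cos_add_Q_sin_le[OF assms, of y] q_norm_nonneg
    by (simp add: abs_le_square_iff[symmetric])
  moreover have "\<bar>(lam - x) * (sin y)\<^sup>2\<bar> \<le> \<bar>lam - x\<bar> * 1"
    unfolding abs_mult using abs_sin_le_one[of y]
    by (intro mult_mono) (auto simp: abs_square_le_1)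
  ultimately show ?thesis
    unfolding prufer_rhs_def by (intro order_trans[OF abs_triangle_ineq] add_mono) simp_all
qed

lemma continuous_prufer_rhs: "continuous_on ({0..} \<times> UNIV) (\<lambda>(x, y). prufer_rhs lam x y)"
proof -
  have "continuous_on ({0..} \<times> UNIV) (\<lambda>z::real \<times> real. Q (fst z))"
    by (rule continuous_on_compose2[OF continuous_Q]) (auto intro!: continuous_intros)
  then show ?thesis
    unfolding prufer_rhs_def case_prod_beta by (intro continuous_intros)
qed

definition theta :: "real \<Rightarrow> real \<Rightarrow> real" where
  "theta lam = (SOME y. y 0 = pi / 2 \<and>
     (\<forall>x\<ge>0. (y has_real_derivative prufer_rhs lam x (y x)) (at x within {0..})))"

lemma theta_0 [simp]: "theta lam 0 = pi / 2"
  and theta_deriv: "0 \<le> x \<Longrightarrow>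
    (theta lam has_real_derivative prufer_rhs lam x (theta lam x)) (at x within {0..})"
proof -
  interpret lipschitz_ivp "prufer_rhs lam" "prufer_lipschitz lam" 0 "pi / 2"
  proof unfold_locales
    show "continuous_on {0..} (prufer_lipschitz lam)"
      unfolding prufer_lipschitz_def by (intro continuous_intros)
  qed (auto simp: dist_real_def intro: continuous_prufer_rhs prufer_rhs_lipschitz)
  have "\<exists>y. y 0 = pi / 2 \<and>
     (\<forall>x\<ge>0. (y has_real_derivative prufer_rhs lam x (y x)) (at x within {0..}))"
    using global_solution_exists unfolding has_real_derivative_iff_has_vector_derivative by metis
  from someI_ex[OF this] show "theta lam 0 = pi / 2" "0 \<le> x \<Longrightarrow>
    (theta lam has_real_derivative prufer_rhs lam x (theta lam x)) (at x within {0..})"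
    unfolding theta_def by auto
qed

lemma continuous_theta: "continuous_on {0..} (theta lam)"
  by (rule DERIV_within_imp_continuous_on) (auto intro: theta_deriv)

definition log_amp_deriv :: "real \<Rightarrow> real \<Rightarrow> real" where
  "log_amp_deriv lam x = Q x * ((sin (theta lam x))\<^sup>2 - (cos (theta lam x))\<^sup>2)
     + (1 + quasi_potential lam x) * (sin (theta lam x) * cos (theta lam x))"

definition amp :: "real \<Rightarrow> real \<Rightarrow> real" where
  "amp lam x = exp (integral {0..x} (log_amp_deriv lam))"

definition u :: "real \<Rightarrow> real \<Rightarrow> real" where
  "u lam x = amp lam x * sin (theta lam x)"

definition v :: "real \<Rightarrow> real \<Rightarrow> real" where
  "v lam x = amp lam x * cos (theta lam x)"

lemma amp_pos: "0 < amp lam x"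
  by (simp add: amp_def)

lemma u_0 [simp]: "u lam 0 = 1" and v_0 [simp]: "v lam 0 = 0"
  by (simp_all add: u_def v_def amp_def)

lemma u_squared_plus_v_squared: "(u lam x)\<^sup>2 + (v lam x)\<^sup>2 = (amp lam x)\<^sup>2"
  by (simp add: u_def v_def power_mult_distrib flip: distrib_left)

lemma u_squared_le_amp_squared: "(u lam x)\<^sup>2 \<le> (amp lam x)\<^sup>2"
  by (simp flip: u_squared_plus_v_squared)

lemma amp_deriv:
  assumes "0 \<le> x"
  shows "(amp lam has_real_derivative amp lam x * log_amp_deriv lam x) (at x within {0..})"
proof -
  have "continuous_on {0..} (log_amp_deriv lam)"
    unfolding log_amp_deriv_def
    by (intro continuous_intros continuous_Q continuous_quasi_potential continuous_theta)
  from integral_has_vector_derivative_atLeast[OF this assms] show ?thesis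
    unfolding amp_def has_real_derivative_iff_has_vector_derivative[symmetric]
    by (auto intro!: derivative_eq_intros)
qed

lemma quasi_solution_u_v: "quasi_solution lam (u lam) (v lam)"
  unfolding quasi_solution_def
proof (intro allI impI conjI)
  fix x :: real assume "0 \<le> x"
  define r S C where "r = amp lam x" and "S = sin (theta lam x)" and "C = cos (theta lam x)"
  have sin_cos_squared: "S\<^sup>2 + C\<^sup>2 = 1" by (simp add: S_def C_def)
  have "(u lam has_real_derivative
      r * log_amp_deriv lam x * S + C * prufer_rhs lam x (theta lam x) * r)
      (at x within {0..})"
    unfolding u_def r_def S_def C_def
    by (intro DERIV_mult DERIV_chain2[OF DERIV_sin] theta_deriv amp_deriv \<open>0 \<le> x\<close>)
  also have "r * log_amp_deriv lam x * S + C * prufer_rhs lam x (theta lam x) * r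
      = Q x * (r * S) + r * C"
    using sin_cos_squared
    unfolding log_amp_deriv_def prufer_rhs_def quasi_potential_def S_def[symmetric] C_def[symmetric]
    by algebra
  finally show "(u lam has_real_derivative Q x * u lam x + v lam x) (at x within {0..})"
    unfolding u_def v_def r_def S_def C_def .
  have "(v lam has_real_derivative
      r * log_amp_deriv lam x * C + - S * prufer_rhs lam x (theta lam x) * r)
      (at x within {0..})"
    unfolding v_def r_def S_def C_def
    by (intro DERIV_mult DERIV_chain2[OF DERIV_cos] theta_deriv amp_deriv \<open>0 \<le> x\<close>)
  also have "r * log_amp_deriv lam x * C + - S * prufer_rhs lam x (theta lam x) * r
      = quasi_potential lam x * (r * S) - Q x * (r * C)"
    using sin_cos_squared
    unfolding log_amp_deriv_def prufer_rhs_def quasi_potential_def S_def[symmetric] C_def[symmetric]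
    by algebra
  finally show "(v lam has_real_derivative quasi_potential lam x * u lam x - Q x * v lam x)
      (at x within {0..})"
    unfolding u_def v_def r_def S_def C_def .
qed

lemmas u_deriv = quasi_solutionD(1)[OF quasi_solution_u_v]
lemmas v_deriv = quasi_solutionD(2)[OF quasi_solution_u_v]

lemma continuous_u: "continuous_on {0..} (u lam)" and continuous_v: "continuous_on {0..} (v lam)"
  by (rule DERIV_within_imp_continuous_on, auto intro: u_deriv v_deriv)+

lemma continuous_u_squared: "continuous_on {0..} (\<lambda>x. (u lam x)\<^sup>2)"
  by (intro continuous_intros continuous_u)

lemma continuous_amp_squared: "continuous_on {0..} (\<lambda>x. (amp lam x)\<^sup>2)"
  unfolding u_squared_plus_v_squared[symmetric]
  by (intro continuous_intros continuous_u continuous_v)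

lemmas u_squared_integrable_on_Icc =
  continuous_on_atLeast_imp_integrable_on_Icc[OF continuous_u_squared]

lemmas amp_squared_integrable_on_Icc =
  continuous_on_atLeast_imp_integrable_on_Icc[OF continuous_amp_squared]

lemma quasi_solution_eq_multiple_u:
  assumes "quasi_solution lam U V" "V 0 = 0" "0 \<le> x"
  shows "U x = U 0 * u lam x"
proof -
  have "U x - U 0 * u lam x = 0"
    by (rule quasi_solution_zero[OF quasi_solution_diff_scaled[OF assms(1) quasi_solution_u_v]])
      (use assms in auto)
  then show ?thesis by simp
qed

subsection \<open>Eigenfunctions\<close>

lemma eigenfunction_imp_quasi_solution:
  assumes "is_eigenfunction_N q lam phi"
  obtains w where "quasi_solution lam phi w" "w 0 = 0"
proof -
  obtain phi1 phi2 where phi: "loc_AC_deriv phi phi1" and phi1: "loc_AC_deriv phi1 phi2"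
    and bc: "phi1 0 = 0"
    and ae: "AE x in lebesgue. 0 \<le> x \<longrightarrow> - phi2 x + (x + q x) * phi x = lam * phi x"
    using assms unfolding is_eigenfunction_N_def by blast
  define w where "w x = phi1 x + (- Q x) * phi x" for x
  have cont: "continuous_on {0..} phi" "continuous_on {0..} phi1"
    using phi phi1 loc_AC_deriv_continuous_on by blast+
  have "loc_AC_deriv (\<lambda>x. - Q x) (\<lambda>x. - q x)"
    using loc_AC_deriv_Q unfolding loc_AC_deriv_def
    by (auto simp: absolutely_integrable_on_def intro: integrable_neg)
  then have "loc_AC_deriv w (\<lambda>x. phi2 x + (- q x * phi x + (- Q x) * phi1 x))"
    unfolding w_def by (intro loc_AC_deriv_add loc_AC_deriv_mult phi phi1)
  then have "loc_AC_deriv w (\<lambda>x. (x - lam) * phi x - Q x * phi1 x)"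
    by (rule loc_AC_deriv_cong_AE) (use ae in \<open>eventually_elim, auto simp: algebra_simps\<close>)
  then have "(w has_real_derivative (x - lam) * phi x - Q x * phi1 x) (at x within {0..})"
    if "0 \<le> x" for x
    by (rule loc_AC_deriv_has_real_derivative) (intro continuous_intros cont continuous_Q that)+
  moreover have "(phi has_real_derivative phi1 x) (at x within {0..})" if "0 \<le> x" for x
    by (rule loc_AC_deriv_has_real_derivative[OF phi cont(2) that])
  ultimately have "quasi_solution lam phi w"
    by (simp add: quasi_solution_def w_def quasi_potential_def algebra_simps power2_eq_square)
  then show ?thesis
    by (rule that) (simp add: w_def bc)
qed

lemma eigenfunction_eq_multiple_u:
  assumes "is_eigenfunction_N q lam phi" "0 \<le> x"
  shows "phi x = phi 0 * u lam x"
  using eigenfunction_imp_quasi_solution[OF assms(1)] quasi_solution_eq_multiple_u assms(2) by metis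

lemma eigenfunction_0_neq_0:
  assumes "is_eigenfunction_N q lam phi"
  shows "phi 0 \<noteq> 0"
proof
  assume "phi 0 = 0"
  then have "phi x = 0" if "0 \<le> x" for x
    using eigenfunction_eq_multiple_u[OF assms that] by simp
  with assms show False unfolding is_eigenfunction_N_def by blast
qed

definition u_norm_sq :: "real \<Rightarrow> real" where
  "u_norm_sq lam = integral {0..} (\<lambda>x. (u lam x)\<^sup>2)"

lemma eigenfunction_quotient:
  assumes "is_eigenfunction_N q lam phi"
  shows "integral {0..} (\<lambda>x. (phi x)\<^sup>2) / (phi 0)\<^sup>2 = u_norm_sq lam"
proof -
  have "integral {0..} (\<lambda>x. (phi x)\<^sup>2) = integral {0..} (\<lambda>x. (phi 0)\<^sup>2 * (u lam x)\<^sup>2)"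
    using eigenfunction_eq_multiple_u[OF assms]
    by (intro Henstock_Kurzweil_Integration.integral_cong) (metis atLeast_iff power_mult_distrib)
  then show ?thesis
    using eigenfunction_0_neq_0[OF assms] by (simp add: u_norm_sq_def)
qed

definition du :: "real \<Rightarrow> real \<Rightarrow> real" where
  "du lam x = Q x * u lam x + v lam x"

lemma continuous_du: "continuous_on {0..} (du lam)"
  unfolding du_def by (intro continuous_intros continuous_Q continuous_u continuous_v)

lemma loc_AC_deriv_u: "loc_AC_deriv (u lam) (du lam)"
  by (rule loc_AC_deriv_of_C1[OF _ continuous_du]) (simp add: du_def u_deriv)

lemma loc_AC_deriv_du: "loc_AC_deriv (du lam) (\<lambda>x. (x + q x - lam) * u lam x)"
proof -
  have "loc_AC_deriv (v lam) (\<lambda>x. quasi_potential lam x * u lam x - Q x * v lam x)"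
    by (intro loc_AC_deriv_of_C1 v_deriv continuous_intros continuous_quasi_potential continuous_Q
        continuous_u continuous_v)
  from loc_AC_deriv_add[OF loc_AC_deriv_mult[OF loc_AC_deriv_Q loc_AC_deriv_u[of lam]] this]
  have "loc_AC_deriv (du lam) (\<lambda>x. (q x * u lam x + Q x * du lam x)
      + (quasi_potential lam x * u lam x - Q x * v lam x))"
    by (simp add: du_def[abs_def])
  then show ?thesis
    by (rule loc_AC_deriv_cong_AE)
      (simp add: du_def quasi_potential_def algebra_simps power2_eq_square)
qed

lemma u_is_eigenfunction:
  assumes "(\<lambda>x. (u lam x)\<^sup>2) integrable_on {0..}"
  shows "is_eigenfunction_N q lam (u lam)"
  unfolding is_eigenfunction_N_def
proof (intro conjI exI)
  have residual_eq: "- ((x + q x - lam) * u lam x) + (x + q x) * u lam x = lam * u lam x" for x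
    by (simp add: algebra_simps)
  show "(\<lambda>x. (- ((x + q x - lam) * u lam x) + (x + q x) * u lam x)\<^sup>2) integrable_on {0..}"
    unfolding residual_eq power_mult_distrib by (rule integrable_on_mult_right[OF assms])
  show "AE x in lebesgue. 0 \<le> x \<longrightarrow>
      - ((x + q x - lam) * u lam x) + (x + q x) * u lam x = lam * u lam x"
    unfolding residual_eq by simp
  show "du lam 0 = 0" by (simp add: du_def)
  show "0 \<le> (0::real)" "u lam 0 \<noteq> 0" by simp_all
qed (rule loc_AC_deriv_u loc_AC_deriv_du assms)+

lemma eigenvalue_iff_u_square_integrable:
  "lam \<in> eigenvalues_N q \<longleftrightarrow> (\<lambda>x. (u lam x)\<^sup>2) integrable_on {0..}"
proof
  assume "lam \<in> eigenvalues_N q"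
  then obtain phi where phi: "is_eigenfunction_N q lam phi"
    by (auto simp: eigenvalues_N_def)
  then have "(\<lambda>x. (phi x)\<^sup>2) integrable_on {0..}"
    unfolding is_eigenfunction_N_def by blast
  then have "(\<lambda>x. (1 / (phi 0)\<^sup>2) * (phi x)\<^sup>2) integrable_on {0..}"
    by (rule integrable_on_mult_right)
  moreover have "(1 / (phi 0)\<^sup>2) * (phi x)\<^sup>2 = (u lam x)\<^sup>2" if "x \<in> {0..}" for x
  proof -
    have "(phi x)\<^sup>2 = (phi 0)\<^sup>2 * (u lam x)\<^sup>2"
      using eigenfunction_eq_multiple_u[OF phi, of x] that
      by (simp only: atLeast_iff power_mult_distrib)
    then show ?thesis using eigenfunction_0_neq_0[OF phi] by simp
  qed
  ultimately show "(\<lambda>x. (u lam x)\<^sup>2) integrable_on {0..}"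
    by (rule integrable_eq)
next
  assume "(\<lambda>x. (u lam x)\<^sup>2) integrable_on {0..}"
  then show "lam \<in> eigenvalues_N q"
    using u_is_eigenfunction by (auto simp: eigenvalues_N_def)
qed

subsection \<open>The classically forbidden region\<close>

definition flux :: "real \<Rightarrow> real \<Rightarrow> real" where
  "flux lam x = u lam x * v lam x"

definition form_density :: "real \<Rightarrow> real \<Rightarrow> real" where
  "form_density lam x = (v lam x)\<^sup>2 + quasi_potential lam x * (u lam x)\<^sup>2"

definition forbidden_start :: "real \<Rightarrow> real" where
  "forbidden_start lam = max 0 (lam + q_norm\<^sup>2 + 1)"

lemma forbidden_start_nonneg: "0 \<le> forbidden_start lam"
  by (simp add: forbidden_start_def)

lemma forbidden_start_le_imp_nonneg: "forbidden_start lam \<le> x \<Longrightarrow> 0 \<le> x"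
  by (simp add: forbidden_start_def)

lemma forbidden_start_eq: "0 \<le> lam \<Longrightarrow> forbidden_start lam = lam + q_norm\<^sup>2 + 1"
  by (simp add: forbidden_start_def)

lemma forbidden_start_mono: "lam \<le> lam' \<Longrightarrow> forbidden_start lam \<le> forbidden_start lam'"
  by (auto simp: forbidden_start_def)

lemma less_forbidden_start: "lam < forbidden_start lam"
  by (simp add: forbidden_start_def less_max_iff_disj add_nonneg_pos)

lemma quasi_potential_ge_1: "forbidden_start lam \<le> x \<Longrightarrow> 1 \<le> quasi_potential lam x"
  using Q_power2_le[of x] by (simp add: forbidden_start_def quasi_potential_def)

lemma flux_eq_amp: "flux lam x = (amp lam x)\<^sup>2 * (sin (theta lam x) * cos (theta lam x))"
  by (simp add: flux_def u_def v_def power2_eq_square)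

lemma abs_flux_le: "\<bar>flux lam x\<bar> \<le> (amp lam x)\<^sup>2"
  using sum_squares_bound[of "u lam x" "v lam x"] sum_squares_bound[of "u lam x" "- v lam x"]
    zero_le_power2[of "amp lam x"]
  by (simp add: flux_def flip: u_squared_plus_v_squared)

lemma continuous_flux: "continuous_on {0..} (flux lam)"
  unfolding flux_def by (intro continuous_intros continuous_u continuous_v)

lemma continuous_form_density: "continuous_on {0..} (form_density lam)"
  unfolding form_density_def
  by (intro continuous_intros continuous_u continuous_v continuous_quasi_potential)

lemmas flux_integrable_on_Icc =
  continuous_on_atLeast_imp_integrable_on_Icc[OF continuous_flux]

lemmas form_density_integrable_on_Icc =
  continuous_on_atLeast_imp_integrable_on_Icc[OF continuous_form_density]

lemma flux_deriv:
  assumes "0 \<le> x"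
  shows "(flux lam has_real_derivative form_density lam x) (at x within {0..})"
  unfolding flux_def
  by (rule DERIV_cong[OF DERIV_mult[OF u_deriv v_deriv]])
    (simp_all add: assms form_density_def power2_eq_square algebra_simps)

lemma amp_squared_le_form_density:
  assumes "forbidden_start lam \<le> x"
  shows "(amp lam x)\<^sup>2 \<le> form_density lam x"
  using mult_right_mono[OF quasi_potential_ge_1[OF assms], of "(u lam x)\<^sup>2"]
  by (simp add: form_density_def flip: u_squared_plus_v_squared)

lemma flux_strict_mono:
  assumes "forbidden_start lam \<le> a" "a < b"
  shows "flux lam a < flux lam b"
proof (rule DERIV_within_pos_imp_less[OF assms(2), of "{0..}"])
  have "0 \<le> a" by (rule forbidden_start_le_imp_nonneg[OF assms(1)])
  then show "{a..b} \<subseteq> {0..}" by auto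
  show "(flux lam has_real_derivative form_density lam x) (at x within {0..})" if "x \<in> {a..b}" for x
    using that \<open>0 \<le> a\<close> by (intro flux_deriv) auto
  show "0 < form_density lam x" if "x \<in> {a<..<b}" for x
  proof -
    have "0 < (amp lam x)\<^sup>2" by (simp add: amp_pos less_imp_neq[symmetric])
    also have "\<dots> \<le> form_density lam x"
      using that assms by (intro amp_squared_le_form_density) auto
    finally show ?thesis .
  qed
qed

lemma integral_form_density:
  assumes "0 \<le> a" "a \<le> b"
  shows "integral {a..b} (form_density lam) = flux lam b - flux lam a"
  using loc_AC_deriv_increment[OF loc_AC_deriv_of_C1[OF flux_deriv continuous_form_density] assms]
  by simp

lemma integral_amp_squared_le:
  assumes "forbidden_start lam \<le> a" "a \<le> b"
  shows "integral {a..b} (\<lambda>x. (amp lam x)\<^sup>2) \<le> flux lam b - flux lam a"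
proof -
  have "0 \<le> a" by (rule forbidden_start_le_imp_nonneg[OF assms(1)])
  then have "integral {a..b} (\<lambda>x. (amp lam x)\<^sup>2) \<le> integral {a..b} (form_density lam)"
    using assms amp_squared_le_form_density
    by (intro integral_le amp_squared_integrable_on_Icc
        form_density_integrable_on_Icc) auto
  then show ?thesis
    by (simp add: integral_form_density \<open>0 \<le> a\<close> assms(2))
qed

lemma integral_u_squared_le:
  assumes "0 \<le> a"
  shows "integral {a..b} (\<lambda>x. (u lam x)\<^sup>2) \<le> integral {a..b} (\<lambda>x. (amp lam x)\<^sup>2)"
  by (intro integral_le u_squared_integrable_on_Icc[OF assms]
      amp_squared_integrable_on_Icc[OF assms])
    (rule u_squared_le_amp_squared)

lemma eigenvalueI_flux_nonpos:
  assumes nonpos: "\<And>x. forbidden_start lam < x \<Longrightarrow> flux lam x \<le> 0"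
  shows "lam \<in> eigenvalues_N q"
proof -
  let ?a = "forbidden_start lam" and ?f = "\<lambda>x. (u lam x)\<^sup>2"
  note int = u_squared_integrable_on_Icc[where lam = lam]
  have "?f integrable_on {?a..}"
  proof (rule nonneg_integrable_on_atLeastI)
    fix x assume x: "?a \<le> x"
    have "integral {?a..x} ?f \<le> flux lam x - flux lam ?a"
      using integral_u_squared_le[OF forbidden_start_nonneg] integral_amp_squared_le[OF order_refl x]
      by (rule order_trans)
    also have "flux lam x \<le> 0"
      using flux_strict_mono[OF x, of "x + 1"] nonpos[of "x + 1"] x by simp
    finally show "integral {?a..x} ?f \<le> - flux lam ?a" by simp
  qed (auto intro: int forbidden_start_nonneg)
  moreover have "{0..?a} \<inter> {?a..} = {?a}" "{0..?a} \<union> {?a..} = {0..}"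
    using forbidden_start_nonneg[of lam] by auto
  ultimately have "?f integrable_on {0..}"
    using integrable_Un[of "{0..?a}" "{?a..}" ?f] int by simp
  then show ?thesis
    by (simp add: eigenvalue_iff_u_square_integrable)
qed

lemma u_squared_increment:
  assumes "0 \<le> a" "a \<le> b"
  shows "\<bar>(u lam b)\<^sup>2 - (u lam a)\<^sup>2 - 2 * integral {a..b} (flux lam)\<bar>
    \<le> 2 * q_norm * integral {a..b} (\<lambda>x. (u lam x)\<^sup>2)"
proof -
  let ?g = "\<lambda>x. 2 * Q x * (u lam x)\<^sup>2"
  have cont: "continuous_on {0..} ?g"
    by (intro continuous_intros continuous_Q continuous_u)
  note int = continuous_on_atLeast_imp_integrable_on_Icc[OF _ assms(1)]
  note int_g = int[OF cont] and int_flux = integrable_on_mult_right[OF int[OF continuous_flux], of 2]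
  have "loc_AC_deriv (\<lambda>x. (u lam x)\<^sup>2) (\<lambda>x. ?g x + 2 * flux lam x)"
  proof (rule loc_AC_deriv_of_C1)
    show "((\<lambda>x. (u lam x)\<^sup>2) has_real_derivative ?g x + 2 * flux lam x) (at x within {0..})"
      if "0 \<le> x" for x
      by (rule DERIV_cong[OF DERIV_power[OF u_deriv[OF that], of lam 2]])
        (simp add: flux_def power2_eq_square algebra_simps)
    show "continuous_on {0..} (\<lambda>x. ?g x + 2 * flux lam x)"
      by (intro continuous_intros cont continuous_flux)
  qed
  from loc_AC_deriv_increment[OF this assms]
  have "(u lam b)\<^sup>2 - (u lam a)\<^sup>2 - 2 * integral {a..b} (flux lam) = integral {a..b} ?g"
    using integral_add[OF int_g int_flux] by simp
  also have "norm \<dots> \<le> integral {a..b} (\<lambda>x. 2 * q_norm * (u lam x)\<^sup>2)"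
  proof (rule integral_norm_bound_integral[OF int_g])
    show "(\<lambda>x. 2 * q_norm * (u lam x)\<^sup>2) integrable_on {a..b}"
      by (rule integrable_on_mult_right[OF int[OF continuous_u_squared]])
    fix x assume "x \<in> {a..b}"
    then have "\<bar>Q x\<bar> * (u lam x)\<^sup>2 \<le> q_norm * (u lam x)\<^sup>2"
      using assms by (intro mult_right_mono abs_Q_le) auto
    then show "norm (2 * Q x * (u lam x)\<^sup>2) \<le> 2 * q_norm * (u lam x)\<^sup>2"
      by (simp add: abs_mult)
  qed
  finally show ?thesis by simp
qed

lemma eigenvalue_integral_u_squared_le:
  assumes "lam \<in> eigenvalues_N q" "0 \<le> a"
  shows "integral {a..b} (\<lambda>x. (u lam x)\<^sup>2) \<le> u_norm_sq lam"
  unfolding u_norm_sq_def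
  by (rule integral_Icc_le_integral_atLeast)
    (use assms eigenvalue_iff_u_square_integrable in auto)

text \<open>If \<open>flux lam a = c > 0\<close>, then \<open>flux lam x \<ge> c\<close> for all \<open>x \<ge> a\<close> and \<open>(u lam)\<^sup>2\<close> grows linearly.\<close>

lemma eigenvalue_flux_nonpos:
  assumes eig: "lam \<in> eigenvalues_N q" and a: "forbidden_start lam \<le> a"
  shows "flux lam a \<le> 0"
proof (rule ccontr)
  define c where "c = flux lam a"
  assume "\<not> flux lam a \<le> 0"
  then have "0 < c" by (simp add: c_def)
  have "0 \<le> a" by (rule forbidden_start_le_imp_nonneg[OF a])
  have growth: "2 * (c * (x - a)) - 2 * q_norm * u_norm_sq lam \<le> (u lam x)\<^sup>2" if "a \<le> x" for x
  proof -
    have "c \<le> flux lam y" if "y \<in> {a..x}" for y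
      using flux_strict_mono[OF a, of y] that by (cases "y = a") (auto simp: c_def)
    then have "integral {a..x} (\<lambda>_. c) \<le> integral {a..x} (flux lam)"
      by (intro integral_le flux_integrable_on_Icc[OF \<open>0 \<le> a\<close>]) auto
    then have "c * (x - a) \<le> integral {a..x} (flux lam)"
      using that by (simp add: mult.commute)
    moreover have "2 * q_norm * integral {a..x} (\<lambda>x. (u lam x)\<^sup>2) \<le> 2 * q_norm * u_norm_sq lam"
      using q_norm_nonneg by (intro mult_left_mono eigenvalue_integral_u_squared_le eig \<open>0 \<le> a\<close>) auto
    ultimately show ?thesis
      using u_squared_increment[OF \<open>0 \<le> a\<close> that, of lam] zero_le_power2[of "u lam a"]
      unfolding abs_le_iff by linarith
  qed
  have "\<exists>\<^sub>F x in at_top. (u lam x)\<^sup>2 < 1"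
    by (rule frequently_less_of_bounded_integral[where a = 0])
      (auto intro: u_squared_integrable_on_Icc
        eigenvalue_integral_u_squared_le[OF eig])
  then have "\<exists>\<^sub>F x in at_top. (u lam x)\<^sup>2 < 1 \<and>
      max a (a + (1 + 2 * q_norm * u_norm_sq lam) / (2 * c)) \<le> x"
    by (rule frequently_eventually_frequently[OF _ eventually_ge_at_top])
  then obtain x where x: "(u lam x)\<^sup>2 < 1" "a \<le> x"
    "(1 + 2 * q_norm * u_norm_sq lam) / (2 * c) \<le> x - a"
    by (auto dest!: frequently_ex)
  then have "1 + 2 * q_norm * u_norm_sq lam \<le> 2 * (c * (x - a))"
    using \<open>0 < c\<close> by (simp add: field_simps)
  then show False
    using growth[OF x(2)] x(1) by linarith
qed

lemma eigenvalue_flux_neg: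
  assumes "lam \<in> eigenvalues_N q" "forbidden_start lam \<le> x"
  shows "flux lam x < 0"
  using flux_strict_mono[OF assms(2), of "x + 1"] eigenvalue_flux_nonpos[OF assms(1), of "x + 1"]
    assms(2)
  by simp

lemma eigenvalue_integral_form_density_le:
  assumes "lam \<in> eigenvalues_N q" "forbidden_start lam \<le> a" "a \<le> b"
  shows "integral {a..b} (form_density lam) \<le> - flux lam a"
  using eigenvalue_flux_nonpos[OF assms(1), of b] assms
  by (simp add: integral_form_density forbidden_start_le_imp_nonneg)

subsection \<open>Dependence of the Pruefer angle on the spectral parameter\<close>

lemma prufer_rhs_lipschitz_Icc:
  assumes "0 \<le> x" "x \<le> b"
  shows "\<bar>prufer_rhs lam x y - prufer_rhs lam x z\<bar> \<le> prufer_lipschitz lam b * \<bar>y - z\<bar>"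
proof -
  have "prufer_lipschitz lam x * \<bar>y - z\<bar> \<le> prufer_lipschitz lam b * \<bar>y - z\<bar>"
    using assms by (intro mult_right_mono) (auto simp: prufer_lipschitz_def)
  then show ?thesis
    using prufer_rhs_lipschitz[OF assms(1), of lam y z] by linarith
qed

lemma theta_ge_pi_multiple:
  fixes m :: nat
  assumes "0 \<le> a" "a \<le> b" "real m * pi \<le> theta lam a"
  shows "real m * pi \<le> theta lam b"
proof -
  have "0 \<le> theta lam b - real m * pi"
  proof (rule differential_inequality_nonneg[OF assms(2), of "{0..}"])
    fix x assume x: "x \<in> {a..b}"
    then show "((\<lambda>x. theta lam x - real m * pi) has_real_derivative
        prufer_rhs lam x (theta lam x) - 0) (at x within {0..})"
      using assms by (intro DERIV_diff theta_deriv DERIV_const) auto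
    have "prufer_rhs lam x (real m * pi) = 1"
      by (simp add: prufer_rhs_def flip: power_mult)
    then show "- prufer_lipschitz lam b * \<bar>theta lam x - real m * pi\<bar>
          \<le> prufer_rhs lam x (theta lam x) - 0"
      using prufer_rhs_lipschitz_Icc[of x b lam "theta lam x" "real m * pi"] x assms
      by (simp add: abs_le_iff)
  qed (use assms in auto)
  then show ?thesis by simp
qed

lemma theta_le_half_pi_multiple:
  fixes m :: nat
  assumes "forbidden_start lam \<le> a" "a \<le> b" "theta lam a \<le> (real m + 1/2) * pi"
  shows "theta lam b \<le> (real m + 1/2) * pi"
proof -
  let ?c = "(real m + 1/2) * pi"
  have "0 \<le> a" by (rule forbidden_start_le_imp_nonneg[OF assms(1)])
  have "0 \<le> ?c - theta lam b"
  proof (rule differential_inequality_nonneg[OF assms(2), of "{0..}"])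
    fix x assume x: "x \<in> {a..b}"
    then show "((\<lambda>x. ?c - theta lam x) has_real_derivative 0 - prufer_rhs lam x (theta lam x))
        (at x within {0..})"
      using \<open>0 \<le> a\<close> by (intro DERIV_diff theta_deriv DERIV_const) auto
    have c_eq: "?c = pi / 2 + real m * pi" by (simp add: algebra_simps)
    have "prufer_rhs lam x ?c = - quasi_potential lam x"
      unfolding c_eq quasi_potential_def
      by (simp add: prufer_rhs_def sin_add cos_add power_mult_distrib flip: power_mult)
    then have "prufer_rhs lam x ?c \<le> 0"
      using quasi_potential_ge_1[of lam x] x assms by simp
    then show "- prufer_lipschitz lam b * \<bar>?c - theta lam x\<bar> \<le> 0 - prufer_rhs lam x (theta lam x)"
      using prufer_rhs_lipschitz_Icc[of x b lam "theta lam x" ?c] x \<open>0 \<le> a\<close>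
      by (simp add: abs_minus_commute abs_le_iff)
  qed (use assms \<open>0 \<le> a\<close> in auto)
  then show ?thesis by simp
qed

lemma prufer_rhs_diff_spectral:
  "prufer_rhs lam' x y = prufer_rhs lam x y + (lam' - lam) * (sin y)\<^sup>2"
  by (simp add: prufer_rhs_def algebra_simps)

lemma theta_diff_deriv:
  "0 \<le> x \<Longrightarrow> ((\<lambda>x. theta lam' x - theta lam x) has_real_derivative
     prufer_rhs lam' x (theta lam' x) - prufer_rhs lam x (theta lam x)) (at x within {0..})"
  by (intro DERIV_diff theta_deriv)

lemma theta_diff_deriv_ge:
  assumes "lam \<le> lam'" "0 \<le> x" "x \<le> b"
  shows "- prufer_lipschitz lam' b * \<bar>theta lam' x - theta lam x\<bar>
    \<le> prufer_rhs lam' x (theta lam' x) - prufer_rhs lam x (theta lam x)"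
proof -
  have "0 \<le> (lam' - lam) * (sin (theta lam x))\<^sup>2"
    using assms(1) by simp
  then show ?thesis
    using prufer_rhs_lipschitz_Icc[OF assms(2,3), of lam' "theta lam' x" "theta lam x"]
    unfolding prufer_rhs_diff_spectral[of lam' x "theta lam x" lam] by linarith
qed

lemma theta_mono:
  assumes "lam \<le> lam'" "0 \<le> x"
  shows "theta lam x \<le> theta lam' x"
proof -
  have "0 \<le> theta lam' x - theta lam x"
    by (rule differential_inequality_nonneg[OF assms(2), of "{0..}", OF _ theta_diff_deriv
        theta_diff_deriv_ge[OF assms(1)]]) auto
  then show ?thesis by simp
qed

lemma theta_strict_mono:
  assumes "lam < lam'" "0 < b"
  shows "theta lam b < theta lam' b"
proof -
  let ?d = "\<lambda>x. theta lam' x - theta lam x"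
  have "(?d has_real_derivative lam' - lam) (at 0 within {0..})"
    using theta_diff_deriv[of 0 lam' lam] by (simp add: prufer_rhs_def)
  from has_real_derivative_pos_inc_right[OF this] assms(1)
  obtain e where "e > 0" and e: "\<And>h. 0 < h \<Longrightarrow> h < e \<Longrightarrow> ?d 0 < ?d (0 + h)"
    by (metis add_0 atLeast_iff diff_gt_0_iff_gt less_imp_le)
  define h where "h = min b (e/2)"
  have h: "0 < h" "h < e" "h \<le> b" using \<open>e > 0\<close> assms(2) by (auto simp: h_def)
  have "- ?d b \<le> - ?d h * exp ((- prufer_lipschitz lam' b) * (b - h))"
  proof (rule gronwall_within[OF h(3), of "{0..}"])
    show "((\<lambda>x. - ?d x) has_real_derivative
        - (prufer_rhs lam' x (theta lam' x) - prufer_rhs lam x (theta lam x))) (at x within {0..})"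
      if "x \<in> {h..b}" for x
      using that h by (intro DERIV_minus theta_diff_deriv) auto
    show "- (prufer_rhs lam' x (theta lam' x) - prufer_rhs lam x (theta lam x))
        \<le> - prufer_lipschitz lam' b * - ?d x" if x: "x \<in> {h<..<b}" for x
    proof -
      have "0 \<le> ?d x" using theta_mono[of lam lam' x] assms x h by simp
      then show ?thesis
        using theta_diff_deriv_ge[of lam lam' x b] x h assms by (simp add: algebra_simps)
    qed
  qed (use h in auto)
  moreover have "0 < ?d h * exp ((- prufer_lipschitz lam' b) * (b - h))" using e[OF h(1,2)] by simp
  ultimately show ?thesis by linarith
qed

lemma theta_diff_le:
  assumes "lam \<le> lam'" "0 \<le> b" "\<bar>lam'\<bar> \<le> B"
  shows "theta lam' b - theta lam b \<le> (lam' - lam) * exp (prufer_lipschitz B b * b)"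
proof -
  let ?d = "\<lambda>x. theta lam' x - theta lam x" and ?L = "prufer_lipschitz B b"
  define c where "c = (1 + q_norm)\<^sup>2"
  have "1 \<le> c"
    using q_norm_nonneg by (simp add: c_def one_le_power)
  moreover have "?L = 2 * c + 2 * (\<bar>B\<bar> + b)"
    by (simp add: c_def prufer_lipschitz_def)
  ultimately have one_le_L: "1 \<le> ?L"
    using \<open>0 \<le> b\<close> by simp
  have lipschitz_le: "prufer_lipschitz lam' b \<le> ?L"
    using assms(3) by (simp add: prufer_lipschitz_def)
  have "?d b + (lam' - lam) \<le> (?d 0 + (lam' - lam)) * exp (?L * (b - 0))"
  proof (rule gronwall_within[OF assms(2), of "{0..}"])
    show "((\<lambda>x. ?d x + (lam' - lam)) has_real_derivative
        (prufer_rhs lam' x (theta lam' x) - prufer_rhs lam x (theta lam x)) + 0) (at x within {0..})"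
      if "x \<in> {0..b}" for x
      using that by (intro DERIV_add theta_diff_deriv DERIV_const) auto
    fix x assume x: "x \<in> {0<..<b}"
    then have diff_nonneg: "0 \<le> ?d x" using theta_mono[of lam lam' x] assms by simp
    have "prufer_rhs lam' x (theta lam' x) - prufer_rhs lam' x (theta lam x)
          \<le> prufer_lipschitz lam' b * ?d x"
      using prufer_rhs_lipschitz_Icc[of x b lam' "theta lam' x" "theta lam x"] x diff_nonneg by simp
    also have "\<dots> \<le> ?L * ?d x" using lipschitz_le diff_nonneg by (intro mult_right_mono) auto
    finally have "prufer_rhs lam' x (theta lam' x) - prufer_rhs lam' x (theta lam x) \<le> ?L * ?d x" .
    moreover have "(lam' - lam) * (sin (theta lam x))\<^sup>2 \<le> ?L * (lam' - lam)"
      using assms(1) one_le_L abs_sin_le_one[of "theta lam x"]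
      by (subst mult.commute)
        (auto intro!: mult_right_mono order_trans[OF _ one_le_L] simp: abs_square_le_1)
    ultimately show "(prufer_rhs lam' x (theta lam' x) - prufer_rhs lam x (theta lam x)) + 0
        \<le> ?L * (?d x + (lam' - lam))"
      unfolding prufer_rhs_diff_spectral[of lam' x "theta lam x" lam] distrib_left by linarith
  qed auto
  then show ?thesis using assms(1) by simp
qed

lemma isCont_theta_spectral:
  assumes "0 \<le> x"
  shows "isCont (\<lambda>lam. theta lam x) lam"
proof -
  define C where "C = exp (prufer_lipschitz (\<bar>lam\<bar> + 1) x * x)"
  have bound: "\<bar>theta l x - theta lam x\<bar> \<le> \<bar>l - lam\<bar> * C" if l: "\<bar>l - lam\<bar> < 1" for l
  proof (cases "l \<le> lam")
    case True
    then show ?thesis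
      using theta_diff_le[OF True assms, of "\<bar>lam\<bar> + 1"] theta_mono[OF True assms]
      by (simp add: C_def)
  next
    case False
    then have "lam \<le> l" "\<bar>l\<bar> \<le> \<bar>lam\<bar> + 1" using l by linarith+
    then show ?thesis
      using theta_diff_le[of lam l x "\<bar>lam\<bar> + 1"] theta_mono[of lam l x] assms by (simp add: C_def)
  qed
  have "((\<lambda>l. theta l x - theta lam x) \<longlongrightarrow> 0) (at lam)"
  proof (rule Lim_null_comparison)
    show "\<forall>\<^sub>F l in at lam. norm (theta l x - theta lam x) \<le> \<bar>l - lam\<bar> * C"
      unfolding eventually_at using bound by (auto simp: dist_real_def intro!: exI[of _ 1])
    show "((\<lambda>l. \<bar>l - lam\<bar> * C) \<longlongrightarrow> 0) (at lam)"
      by (auto intro!: tendsto_eq_intros)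
  qed
  then show ?thesis by (simp add: isCont_def LIM_zero_iff)
qed

subsection \<open>Indexing the eigenvalues by the Pruefer angle\<close>

definition has_index :: "real \<Rightarrow> nat \<Rightarrow> bool" where
  "has_index lam m \<longleftrightarrow> lam \<in> eigenvalues_N q \<and>
     (\<forall>x\<ge>forbidden_start lam. (real m + 1/2) * pi < theta lam x \<and> theta lam x < (real m + 1) * pi)"

lemma has_indexD:
  assumes "has_index lam m" "forbidden_start lam \<le> x"
  shows "(real m + 1/2) * pi < theta lam x" "theta lam x < (real m + 1) * pi"
  using assms by (auto simp: has_index_def)

lemma eigenvalue_has_index:
  assumes "lam \<in> eigenvalues_N q"
  obtains m where "has_index lam m"
proof
  let ?a = "forbidden_start lam" and ?th = "theta lam"
  have neg: "sin (?th x) * cos (?th x) < 0" if "?a \<le> x" for x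
    using eigenvalue_flux_neg[OF assms that] amp_pos[of lam x]
    by (simp add: flux_eq_amp mult_less_0_iff not_less[symmetric])
  define m where "m = nat \<lfloor>?th ?a / pi\<rfloor>"
  have "0 \<le> ?th ?a"
    using theta_ge_pi_multiple[of 0 ?a 0 lam] forbidden_start_nonneg by simp
  then have "real m \<le> ?th ?a / pi" "?th ?a / pi < real m + 1"
    unfolding m_def by (simp_all add: floor_less_iff[symmetric])
  then have m: "real m * pi \<le> ?th ?a" "?th ?a < (real m + 1) * pi"
    by (simp_all add: field_simps)
  have "(real m + 1/2) * pi < ?th x \<and> ?th x < (real m + 1) * pi" if x: "?a \<le> x" for x
  proof -
    have "real m * pi \<le> ?th x"
      using theta_ge_pi_multiple[OF forbidden_start_nonneg x] m by simp
    then have "(real m + 1/2) * pi < ?th x"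
      using sin_times_cos_nonneg[of m "?th x"] neg[OF x] by linarith
    moreover have "(real m + 1) * pi \<le> (real (Suc m) + 1/2) * pi"
      by (intro mult_right_mono) auto
    then have "?th x \<le> (real (Suc m) + 1/2) * pi"
      using m(2) by (intro theta_le_half_pi_multiple[OF order_refl x]) linarith
    then have "?th x < real (Suc m) * pi"
      using sin_times_cos_nonneg[of "Suc m" "?th x"] neg[OF x] by linarith
    ultimately show ?thesis by (simp add: add.commute)
  qed
  then show "has_index lam m"
    using assms by (simp add: has_index_def)
qed

text \<open>The spectral parameters for which the angle leaves \<open>[(m + 1/2) \<pi>, (m + 1) \<pi>]\<close> above, respectively
  below, form disjoint nonempty open sets, so that the angle stays there for some \<open>lam\<close>.\<close>

definition overshoot :: "nat \<Rightarrow> real set" where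
  "overshoot m = {lam. \<exists>x\<ge>0. (real m + 1) * pi < theta lam x}"

definition undershoot :: "nat \<Rightarrow> real set" where
  "undershoot m = {lam. \<exists>x>forbidden_start lam. theta lam x < (real m + 1/2) * pi}"

lemma continuous_theta_spectral: "0 \<le> x \<Longrightarrow> continuous_on A (\<lambda>lam. theta lam x)"
  by (intro continuous_at_imp_continuous_on ballI isCont_theta_spectral)

lemma open_overshoot: "open (overshoot m)"
proof -
  have "overshoot m = (\<Union>x\<in>{0..}. {lam. (real m + 1) * pi < theta lam x})"
    by (auto simp: overshoot_def)
  also have "open \<dots>"
    by (intro open_UN ballI open_Collect_less continuous_intros continuous_theta_spectral) auto
  finally show ?thesis .
qed

lemma open_undershoot: "open (undershoot m)"
proof -
  have "0 \<le> x" if "forbidden_start lam < x" for lam x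
    by (rule forbidden_start_le_imp_nonneg[OF less_imp_le[OF that]])
  then have "undershoot m = (\<Union>x\<in>{0..}.
      {lam. forbidden_start lam < x \<and> theta lam x < (real m + 1/2) * pi})"
    unfolding undershoot_def by auto
  also have "open \<dots>"
    unfolding forbidden_start_def
    by (intro open_UN ballI open_Collect_conj open_Collect_less continuous_intros
        continuous_theta_spectral) auto
  finally show ?thesis .
qed

lemma overshoot_undershoot_disjoint: "overshoot m \<inter> undershoot m = {}"
proof (rule ccontr)
  assume "overshoot m \<inter> undershoot m \<noteq> {}"
  then obtain lam x y where x: "0 \<le> x" "(real m + 1) * pi < theta lam x"
    and y: "forbidden_start lam < y" "theta lam y < (real m + 1/2) * pi"
    by (auto simp: overshoot_def undershoot_def)
  have "real (Suc m) * pi \<le> theta lam (max x y)"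
    by (rule theta_ge_pi_multiple[of x]) (use x in \<open>auto simp: algebra_simps\<close>)
  moreover have "theta lam (max x y) \<le> (real m + 1/2) * pi"
    by (rule theta_le_half_pi_multiple[of lam y]) (use y in auto)
  ultimately show False
    using pi_gt_zero by (simp add: algebra_simps)
qed

lemma undershoot_nonempty: "undershoot m \<noteq> {}"
proof -
  define l where "l = - (q_norm\<^sup>2 + 1)"
  have "l < 0" unfolding l_def using zero_le_power2[of q_norm] by linarith
  moreover have "(theta l has_real_derivative l) (at 0 within {0..})"
    using theta_deriv[of 0 l] by (simp add: prufer_rhs_def)
  ultimately obtain e where "e > 0"
    and e: "\<And>h. 0 < h \<Longrightarrow> 0 + h \<in> {0..} \<Longrightarrow> h < e \<Longrightarrow> theta l (0 + h) < theta l 0"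
    using has_real_derivative_neg_dec_right by blast
  have "theta l (e/2) < pi / 2"
    using e[of "e/2"] \<open>e > 0\<close> by simp
  also have "\<dots> \<le> (real m + 1/2) * pi"
    by (simp add: algebra_simps)
  finally have "theta l (e/2) < (real m + 1/2) * pi" .
  moreover have "forbidden_start l < e/2"
    using \<open>e > 0\<close> by (simp add: forbidden_start_def l_def)
  ultimately show ?thesis unfolding undershoot_def by blast
qed

subsection \<open>The phase at the beginning of the forbidden region\<close>

text \<open>The angle of \<open>(\<surd>(lam - x) u, v)\<close> rotates with speed \<open>\<surd>(lam - x) + O(1)\<close> up to \<open>x = lam - 1\<close>;
  it agrees with \<open>theta\<close> where \<open>lam - x = 1\<close> and where \<open>theta\<close> is a multiple of \<open>\<pi>/2\<close>.\<close>

lemma theta_before_turning_point: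
  assumes "1 \<le> lam"
  shows "\<bar>(theta lam (lam - 1) + 2/3) - (pi / 2 + 2/3 * sqrt lam ^ 3)\<bar>
        \<le> (q_norm + q_norm\<^sup>2 + 1) * lam"
proof -
  define s where "s x = sqrt (lam - x)" for x
  define phase where "phase x = scaled_angle (s x) (theta lam x) + 2/3 * s x ^ 3" for x
  define speed where "speed x = (s x * ((cos (theta lam x) + Q x * sin (theta lam x))\<^sup>2
        + (s x)\<^sup>2 * (sin (theta lam x))\<^sup>2)
      + sin (theta lam x) * cos (theta lam x) * (- 1 / (2 * s x)))
    / ((cos (theta lam x))\<^sup>2 + (s x)\<^sup>2 * (sin (theta lam x))\<^sup>2)" for x
  have "norm (phase (lam - 1) - phase 0) \<le> (q_norm + q_norm\<^sup>2 + 1) * norm (lam - 1 - 0)"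
  proof (rule field_differentiable_bound[of "{0..lam - 1}"])
    fix x assume x: "x \<in> {0..lam - 1}"
    have s_ge_1: "1 \<le> s x" and s_squared: "(s x)\<^sup>2 = lam - x" using x by (simp_all add: s_def)
    have s_deriv: "(s has_real_derivative - 1 / (2 * s x)) (at x within {0..})"
      unfolding s_def using x by (auto intro!: derivative_eq_intros simp: field_simps)
    have "((\<lambda>x. scaled_angle (s x) (theta lam x)) has_real_derivative speed x) (at x within {0..})"
      using scaled_angle_deriv[OF theta_deriv s_deriv] x s_ge_1
      unfolding speed_def prufer_rhs_def s_squared by simp
    moreover have "((\<lambda>x. 2/3 * s x ^ 3) has_real_derivative - s x) (at x within {0..})"
      using s_ge_1 by (auto intro!: derivative_eq_intros s_deriv simp: field_simps power2_eq_square)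
    ultimately have "(phase has_real_derivative speed x + - s x) (at x within {0..})"
      unfolding phase_def by (rule DERIV_add)
    then show "(phase has_real_derivative speed x + - s x) (at x within {0..lam - 1})"
      by (rule DERIV_subset) auto
    show "norm (speed x + - s x) \<le> q_norm + q_norm\<^sup>2 + 1"
      unfolding speed_def real_norm_def add_uminus_conv_diff
      by (rule scaled_angle_speed_bound) (use s_ge_1 x abs_Q_le in \<open>auto simp: field_simps\<close>)
  qed (use assms in auto)
  also have "\<dots> \<le> (q_norm + q_norm\<^sup>2 + 1) * lam"
    using assms q_norm_nonneg by (intro mult_left_mono) auto
  finally show ?thesis
    by (simp add: phase_def s_def)
qed

lemma theta_across_turning_point:
  assumes "1 \<le> lam"
  shows "\<bar>theta lam (forbidden_start lam) - theta lam (lam - 1)\<bar>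
    \<le> ((1 + q_norm)\<^sup>2 + (q_norm\<^sup>2 + 1)) * (q_norm\<^sup>2 + 2)"
proof -
  have start_eq: "forbidden_start lam = lam + q_norm\<^sup>2 + 1"
    using assms by (simp add: forbidden_start_eq)
  have "norm (theta lam (forbidden_start lam) - theta lam (lam - 1))
      \<le> ((1 + q_norm)\<^sup>2 + (q_norm\<^sup>2 + 1)) * norm (forbidden_start lam - (lam - 1))"
  proof (rule field_differentiable_bound[of "{lam - 1..forbidden_start lam}"])
    fix x assume x: "x \<in> {lam - 1..forbidden_start lam}"
    then have "\<bar>lam - x\<bar> \<le> q_norm\<^sup>2 + 1" "0 \<le> x"
      using assms by (auto simp: start_eq abs_le_iff add_increasing)
    then show "norm (prufer_rhs lam x (theta lam x)) \<le> (1 + q_norm)\<^sup>2 + (q_norm\<^sup>2 + 1)"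
      using abs_prufer_rhs_le[of x lam "theta lam x"] by simp
    show "(theta lam has_real_derivative prufer_rhs lam x (theta lam x))
        (at x within {lam - 1..forbidden_start lam})"
      by (rule DERIV_subset[OF theta_deriv]) (use \<open>0 \<le> x\<close> assms in auto)
  qed (auto simp: start_eq add_increasing)
  then show ?thesis
    by (simp add: start_eq add_increasing add.commute add.left_commute)
qed

lemma theta_forbidden_start_asymp:
  "(\<lambda>lam. theta lam (forbidden_start lam)) \<sim>[at_top] (\<lambda>lam. 2/3 * lam powr (3/2))"
proof (rule smallo_imp_asymp_equiv)
  define A where "A = q_norm + q_norm\<^sup>2 + 1"
  define B where "B = ((1 + q_norm)\<^sup>2 + (q_norm\<^sup>2 + 1)) * (q_norm\<^sup>2 + 2)"
  have "\<forall>\<^sub>F lam in at_top. norm (theta lam (forbidden_start lam) - 2/3 * lam powr (3/2))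
      \<le> (A + B + 3) * norm lam"
    using eventually_ge_at_top[of 1]
  proof eventually_elim
    case (elim lam)
    have "0 \<le> B" unfolding B_def by (intro mult_nonneg_nonneg add_nonneg_nonneg) auto
    then have "B + 3 \<le> (B + 3) * lam" using elim mult_left_mono[of 1 lam "B + 3"] by simp
    moreover have "\<bar>theta lam (forbidden_start lam) - 2/3 * sqrt lam ^ 3\<bar> \<le> A * lam + B + 3"
      using theta_before_turning_point[OF elim] theta_across_turning_point[OF elim]
        pi_less_4 pi_gt_zero
      unfolding A_def[symmetric] B_def[symmetric] abs_le_iff by linarith
    moreover have "lam powr (3/2) = sqrt lam ^ 3"
      using elim by (simp add: powr_half_sqrt_powr powr_numeral real_sqrt_power)
    ultimately show ?case
      using elim by (simp add: distrib_right)
  qed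
  then have "(\<lambda>lam. theta lam (forbidden_start lam) - 2/3 * lam powr (3/2)) \<in> O(\<lambda>lam. lam)"
    by (rule bigoI)
  also have "(\<lambda>lam. lam) \<in> o(\<lambda>lam::real. 2/3 * lam powr (3/2))"
    by real_asymp
  finally show "(\<lambda>lam. theta lam (forbidden_start lam) - 2/3 * lam powr (3/2))
      \<in> o(\<lambda>lam. 2/3 * lam powr (3/2))" .
qed

lemma overshoot_nonempty: "overshoot m \<noteq> {}"
proof -
  have "filterlim (\<lambda>lam::real. 2/3 * lam powr (3/2)) at_top at_top"
    by real_asymp
  then have "filterlim (\<lambda>lam. theta lam (forbidden_start lam)) at_top at_top"
    by (rule asymp_equiv_at_top_transfer[OF asymp_equiv_symI[OF theta_forbidden_start_asymp]])
  then have "\<forall>\<^sub>F lam in at_top. (real m + 1) * pi < theta lam (forbidden_start lam)"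
    by (simp add: filterlim_at_top_dense)
  then obtain lam where "(real m + 1) * pi < theta lam (forbidden_start lam)"
    using eventually_happens' trivial_limit_at_top_linorder by blast
  then show ?thesis
    using forbidden_start_nonneg by (auto simp: overshoot_def)
qed

subsection \<open>Enumeration of the eigenvalues\<close>

lemma ex_has_index: "\<exists>lam. has_index lam m"
proof -
  have "overshoot m \<union> undershoot m \<noteq> UNIV"
    using connected_UNIV[where 'a = real] open_overshoot[of m] open_undershoot[of m]
      overshoot_undershoot_disjoint[of m] overshoot_nonempty[of m] undershoot_nonempty[of m]
    unfolding connected_def by (metis Int_UNIV_right inf_commute subset_UNIV order_refl)
  then obtain lam where lam: "lam \<notin> overshoot m" "lam \<notin> undershoot m" by auto
  have theta_le: "theta lam x \<le> (real m + 1) * pi" if "forbidden_start lam < x" for x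
  proof -
    have "0 \<le> x" by (rule forbidden_start_le_imp_nonneg[OF less_imp_le[OF that]])
    then show ?thesis using lam(1) by (force simp: overshoot_def not_less)
  qed
  have theta_ge: "(real m + 1/2) * pi \<le> theta lam x" if "forbidden_start lam < x" for x
    using lam(2) that by (force simp: undershoot_def not_less)
  have "lam \<in> eigenvalues_N q"
    by (rule eigenvalueI_flux_nonpos)
      (simp add: flux_eq_amp mult_nonneg_nonpos sin_times_cos_nonpos[OF theta_ge theta_le])
  then obtain n where index_n: "has_index lam n" using eigenvalue_has_index by blast
  have "(real n + 1/2) * pi < (real m + 1) * pi" "(real m + 1/2) * pi < (real n + 1) * pi"
    using has_indexD[OF index_n, of "forbidden_start lam + 1"] theta_le[of "forbidden_start lam + 1"]
      theta_ge[of "forbidden_start lam + 1"] by linarith+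
  then have "real n + 1/2 < real m + 1" "real m + 1/2 < real n + 1" by simp_all
  then have "n = m" by linarith
  with index_n show ?thesis by blast
qed

definition wronskian :: "real \<Rightarrow> real \<Rightarrow> real \<Rightarrow> real" where
  "wronskian lam lam' x = u lam' x * v lam x - u lam x * v lam' x"

lemma wronskian_deriv:
  assumes "0 \<le> x"
  shows "(wronskian lam lam' has_real_derivative (lam' - lam) * (u lam x * u lam' x))
      (at x within {0..})"
  unfolding wronskian_def
  by (rule quasi_solution_wronskian_deriv[OF quasi_solution_u_v quasi_solution_u_v assms])

lemma wronskian_eq_amp:
  "wronskian lam lam' x = amp lam x * amp lam' x * sin (theta lam' x - theta lam x)"
  by (simp add: wronskian_def u_def v_def sin_diff algebra_simps)

lemma wronskian_le: "wronskian lam lam' x \<le> (amp lam x)\<^sup>2 + (amp lam' x)\<^sup>2"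
proof -
  have "wronskian lam lam' x \<le> amp lam x * amp lam' x * 1"
    unfolding wronskian_eq_amp using amp_pos by (intro mult_left_mono) (simp_all add: less_imp_le)
  also have "\<dots> \<le> (amp lam x)\<^sup>2 + (amp lam' x)\<^sup>2"
    using sum_squares_bound[of "amp lam x" "amp lam' x"] amp_pos[of lam x] amp_pos[of lam' x]
    by (simp add: mult_pos_pos order_trans[of _ "2 * amp lam x * amp lam' x"])
  finally show ?thesis .
qed

lemma eigenvalues_frequently_wronskian_less:
  assumes "lam \<in> eigenvalues_N q" "lam' \<in> eigenvalues_N q" "0 < e"
  shows "\<exists>\<^sub>F x in at_top. wronskian lam lam' x < e"
proof -
  define a where "a = max (forbidden_start lam) (forbidden_start lam')"
  have a: "0 \<le> a" "forbidden_start lam \<le> a" "forbidden_start lam' \<le> a"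
    using forbidden_start_nonneg[of lam] by (auto simp: a_def)
  note int = amp_squared_integrable_on_Icc[OF a(1)]
  have single: "integral {a..x} (\<lambda>x. (amp l x)\<^sup>2) \<le> - flux l a"
    if "l \<in> eigenvalues_N q" "forbidden_start l \<le> a" "a \<le> x" for l x
    using integral_amp_squared_le[OF that(2,3)] eigenvalue_flux_nonpos[OF that(1), of x] that
    by linarith
  have "integral {a..x} (\<lambda>x. (amp lam x)\<^sup>2 + (amp lam' x)\<^sup>2) \<le> - flux lam a + - flux lam' a"
    if "a \<le> x" for x
    unfolding integral_add[OF int int] by (intro add_mono single assms a that)
  then have "\<exists>\<^sub>F x in at_top. (amp lam x)\<^sup>2 + (amp lam' x)\<^sup>2 < e"
    by (intro frequently_less_of_bounded_integral[OF integrable_add[OF int int] _ \<open>0 < e\<close>])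
  then show ?thesis
    by (rule frequently_mono[rotated]) (use wronskian_le le_less_trans in blast)
qed

text \<open>Two eigenvalues with the same index would have eigenfunctions of equal sign in the forbidden
  region, so that their Wronskian would increase from a positive value and could not come close to \<open>0\<close>.\<close>

lemma has_index_not_less:
  assumes "has_index lam m" "has_index lam' m"
  shows "\<not> lam < lam'"
proof
  assume less: "lam < lam'"
  define a where "a = forbidden_start lam' + 1"
  have a: "forbidden_start lam \<le> a" "forbidden_start lam' \<le> a" "0 < a"
    using forbidden_start_mono[of lam lam'] forbidden_start_nonneg[of lam'] less
    by (auto simp: a_def)
  have angles: "(real m + 1/2) * pi < theta lam x" "theta lam x < (real m + 1) * pi"
    "(real m + 1/2) * pi < theta lam' x" "theta lam' x < (real m + 1) * pi" if "a \<le> x" for x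
    using has_indexD[OF assms(1), of x] has_indexD[OF assms(2), of x] that a by auto
  have mono: "wronskian lam lam' a \<le> wronskian lam lam' x" if "a \<le> x" for x
  proof (rule DERIV_within_nonneg_imp_le[OF that, of "{0..}", OF _ wronskian_deriv])
    fix y assume y: "y \<in> {a<..<x}"
    have "0 < sin (theta lam y) * sin (theta lam' y)"
      using angles[of y] y by (intro sin_times_sin_pos[of m]) (auto simp: algebra_simps)
    then have "0 < (amp lam y * amp lam' y) * (sin (theta lam y) * sin (theta lam' y))"
      by (rule mult_pos_pos[OF mult_pos_pos[OF amp_pos amp_pos]])
    then have "0 < u lam y * u lam' y" by (simp add: u_def mult_ac)
    then show "0 \<le> (lam' - lam) * (u lam y * u lam' y)" using less by simp
  qed (use a in auto)
  have "0 < sin (theta lam' a - theta lam a)"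
    using theta_strict_mono[OF less a(3)] angles[of a]
    by (intro sin_gt_zero) (auto simp: algebra_simps)
  then have "0 < wronskian lam lam' a"
    by (simp add: wronskian_eq_amp amp_pos)
  then have "\<exists>\<^sub>F x in at_top. wronskian lam lam' x < wronskian lam lam' a"
    using assms by (intro eigenvalues_frequently_wronskian_less) (auto simp: has_index_def)
  then have "\<exists>\<^sub>F x in at_top. wronskian lam lam' x < wronskian lam lam' a \<and> a \<le> x"
    by (rule frequently_eventually_frequently[OF _ eventually_ge_at_top])
  then obtain x where "wronskian lam lam' x < wronskian lam lam' a" "a \<le> x"
    by (auto dest: frequently_ex)
  then show False using mono[of x] by linarith
qed

lemma has_index_unique: "has_index lam m \<Longrightarrow> has_index lam' m \<Longrightarrow> lam = lam'"
  using has_index_not_less by (meson linorder_neqE)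

definition mu :: "nat \<Rightarrow> real" where
  "mu m = (SOME lam. has_index lam m)"

lemma has_index_mu: "has_index (mu m) m"
  unfolding mu_def by (rule someI_ex[OF ex_has_index])

lemma mu_eigenvalue: "mu m \<in> eigenvalues_N q"
  using has_index_mu by (simp add: has_index_def)

lemma strict_mono_mu: "strict_mono mu"
proof (rule strict_monoI, rule ccontr)
  fix m n :: nat assume "m < n" "\<not> mu m < mu n"
  then have mu_le: "mu n \<le> mu m" by simp
  let ?a = "forbidden_start (mu m)"
  have "(real n + 1/2) * pi < theta (mu n) ?a"
    by (rule has_indexD(1)[OF has_index_mu forbidden_start_mono[OF mu_le]])
  also have "\<dots> \<le> theta (mu m) ?a"
    by (rule theta_mono[OF mu_le forbidden_start_nonneg])
  also have "\<dots> < (real m + 1) * pi"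
    by (rule has_indexD(2)[OF has_index_mu order_refl])
  finally have "real n + 1/2 < real m + 1" by simp
  then show False using \<open>m < n\<close> by linarith
qed

lemma eigenvalues_eq_range_mu: "eigenvalues_N q = range mu"
proof
  show "eigenvalues_N q \<subseteq> range mu"
    using eigenvalue_has_index has_index_unique has_index_mu by (metis rangeI subsetI)
qed (auto simp: mu_eigenvalue)

lemma eigenvalue_N_Suc: "eigenvalue_N q (Suc m) = mu m"
proof -
  have card: "card {l \<in> eigenvalues_N q. l < mu n} = n" for n
  proof -
    have "{l \<in> eigenvalues_N q. l < mu n} = mu ` {..<n}"
      using strict_mono_less[OF strict_mono_mu] by (auto simp: eigenvalues_eq_range_mu)
    then show ?thesis
      using card_image[of mu "{..<n}"] strict_mono_imp_inj_on[OF strict_mono_mu]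
      by (metis card_lessThan inj_on_subset subset_UNIV)
  qed
  show ?thesis
    unfolding eigenvalue_N_def using card
    by (intro the_equality) (auto simp: eigenvalues_eq_range_mu)
qed

lemma inv_norming_const_N_Suc: "inv_norming_const_N q (Suc m) = u_norm_sq (mu m)"
proof -
  have "\<exists>phi. is_eigenfunction_N q (mu m) phi"
    using mu_eigenvalue[of m] by (simp add: eigenvalues_N_def)
  from eigenfunction_quotient[OF someI_ex[OF this]] show ?thesis
    by (simp add: inv_norming_const_N_def eigenvalue_N_Suc Let_def)
qed

lemma filterlim_mu: "filterlim mu at_top sequentially"
proof -
  have "\<exists>m. c < mu m" for c
  proof (rule ccontr)
    assume "\<not> ?thesis"
    then have mu_le: "mu m \<le> c" for m by (simp add: not_less)
    let ?a = "forbidden_start c"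
    obtain m :: nat where m: "theta c ?a / pi < real m" using reals_Archimedean2 by blast
    have "(real m + 1/2) * pi < theta (mu m) ?a"
      by (rule has_indexD(1)[OF has_index_mu forbidden_start_mono[OF mu_le]])
    also have "\<dots> \<le> theta c ?a" by (rule theta_mono[OF mu_le forbidden_start_nonneg])
    also have "\<dots> < real m * pi" using m by (simp add: field_simps)
    finally show False by simp
  qed
  then show ?thesis
    unfolding filterlim_at_top_gt[where c = 0] eventually_sequentially
    using strict_mono_less_eq[OF strict_mono_mu] by (meson less_imp_le order_trans)
qed

lemma mu_asymp: "mu \<sim>[sequentially] (\<lambda>m. (3/2 * pi * (real (Suc m) - 3/4)) powr (2/3))"
proof -
  let ?th = "\<lambda>m. theta (mu m) (forbidden_start (mu m))"
  have "?th \<sim>[sequentially] (\<lambda>m. (real (Suc m) - 3/4) * pi)"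
  proof (rule asymp_equiv_sandwich_real)
    show "(\<lambda>m. (real m + 1/2) * pi) \<sim>[sequentially] (\<lambda>m. (real (Suc m) - 3/4) * pi)"
      "(\<lambda>m. (real m + 1) * pi) \<sim>[sequentially] (\<lambda>m. (real (Suc m) - 3/4) * pi)"
      by real_asymp+
    show "\<forall>\<^sub>F m in sequentially. ?th m \<in> {(real m + 1/2) * pi..(real m + 1) * pi}"
      using has_indexD[OF has_index_mu order_refl] by (auto intro!: always_eventually less_imp_le)
  qed
  moreover have "?th \<sim>[sequentially] (\<lambda>m. 2/3 * mu m powr (3/2))"
    by (rule asymp_equiv_compose'[OF theta_forbidden_start_asymp filterlim_mu])
  ultimately have "(\<lambda>m. 2/3 * mu m powr (3/2)) \<sim>[sequentially] (\<lambda>m. (real (Suc m) - 3/4) * pi)"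
    using asymp_equiv_symI asymp_equiv_trans by blast
  then have "(\<lambda>m. 3/2 * (2/3 * mu m powr (3/2)))
      \<sim>[sequentially] (\<lambda>m. 3/2 * ((real (Suc m) - 3/4) * pi))"
    by (rule asymp_equiv_mult[OF asymp_equiv_refl])
  then have "(\<lambda>m. (3/2 * (2/3 * mu m powr (3/2))) powr (2/3))
      \<sim>[sequentially] (\<lambda>m. (3/2 * ((real (Suc m) - 3/4) * pi)) powr (2/3))"
    by (rule asymp_equiv_powr_real) simp_all
  moreover have "\<forall>\<^sub>F m in sequentially. (3/2 * (2/3 * mu m powr (3/2))) powr (2/3) = mu m"
    using eventually_compose_filterlim[OF eventually_ge_at_top[of 0] filterlim_mu]
    by eventually_elim (simp add: powr_powr)
  ultimately show ?thesis
    by (auto elim!: asymp_equiv_transfer simp: mult_ac)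
qed

subsection \<open>The energy identity\<close>

definition energy :: "real \<Rightarrow> real \<Rightarrow> real" where
  "energy lam x = (du lam x)\<^sup>2 + (lam - x) * (u lam x)\<^sup>2"

lemma energy_0 [simp]: "energy lam 0 = lam"
  by (simp add: energy_def du_def)

lemma continuous_energy: "continuous_on {0..} (energy lam)"
  unfolding energy_def by (intro continuous_intros continuous_du continuous_u)

lemma loc_AC_deriv_energy:
  "loc_AC_deriv (energy lam) (\<lambda>x. - (u lam x)\<^sup>2 + q x * (2 * (u lam x * du lam x)))"
proof -
  have "loc_AC_deriv (\<lambda>x. lam - x) (\<lambda>x. - 1)"
    by (rule loc_AC_deriv_of_C1) (auto intro!: derivative_eq_intros)
  from loc_AC_deriv_add[OF loc_AC_deriv_mult[OF loc_AC_deriv_du[of lam] loc_AC_deriv_du[of lam]]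
      loc_AC_deriv_mult[OF this loc_AC_deriv_mult[OF loc_AC_deriv_u[of lam] loc_AC_deriv_u[of lam]]]]
  have "loc_AC_deriv (\<lambda>x. du lam x * du lam x + (lam - x) * (u lam x * u lam x))
      (\<lambda>x. - (u lam x)\<^sup>2 + q x * (2 * (u lam x * du lam x)))"
    by (rule loc_AC_deriv_cong_AE) (simp add: power2_eq_square algebra_simps)
  then show ?thesis unfolding energy_def power2_eq_square .
qed

lemma energy_balance:
  assumes "0 \<le> a" "a \<le> b" and u_du_le: "\<And>x. x \<in> {a..b} \<Longrightarrow> 2 * \<bar>u lam x * du lam x\<bar> \<le> M"
  shows "\<bar>energy lam b - energy lam a + integral {a..b} (\<lambda>x. (u lam x)\<^sup>2)\<bar>
    \<le> M * integral {a..b} (\<lambda>x. \<bar>q x\<bar>)"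
proof -
  let ?g = "\<lambda>x. q x * (2 * (u lam x * du lam x))"
  have int_u: "(\<lambda>x. (u lam x)\<^sup>2) integrable_on {a..b}"
    by (rule u_squared_integrable_on_Icc[OF assms(1)])
  have "continuous_on {a..b} (\<lambda>x. 2 * (u lam x * du lam x))"
    using assms(1)
    by (intro continuous_intros continuous_on_subset[OF continuous_u]
        continuous_on_subset[OF continuous_du]) auto
  then have "(\<lambda>x. (2 * (u lam x * du lam x)) * q x) absolutely_integrable_on {a..b}"
    by (intro absolutely_integrable_continuous_mult q_absolutely_integrable_Icc assms(1))
  then have int_g: "?g integrable_on {a..b}"
    using absolutely_integrable_on_realD(1) by (simp add: mult.commute)
  have "energy lam b - energy lam a + integral {a..b} (\<lambda>x. (u lam x)\<^sup>2) = integral {a..b} ?g"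
    using loc_AC_deriv_increment[OF loc_AC_deriv_energy assms(1,2)]
      integral_add[OF integrable_neg[OF int_u] int_g] by simp
  also have "norm \<dots> \<le> integral {a..b} (\<lambda>x. M * \<bar>q x\<bar>)"
  proof (rule integral_norm_bound_integral[OF int_g])
    show "(\<lambda>x. M * \<bar>q x\<bar>) integrable_on {a..b}"
      by (intro integrable_on_mult_right absolutely_integrable_on_realD(2)
          q_absolutely_integrable_Icc assms)
    fix x assume "x \<in> {a..b}"
    then have "\<bar>q x\<bar> * (2 * \<bar>u lam x * du lam x\<bar>) \<le> \<bar>q x\<bar> * M"
      using u_du_le by (intro mult_left_mono) auto
    then show "norm (?g x) \<le> M * \<bar>q x\<bar>" by (simp add: abs_mult mult_ac)
  qed
  finally show ?thesis by simp
qed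

lemma energy_increment_le:
  assumes "0 \<le> a" "a \<le> b" "\<And>x. x \<in> {a..b} \<Longrightarrow> 2 * \<bar>u lam x * du lam x\<bar> \<le> M"
  shows "energy lam b - energy lam a \<le> M * integral {a..b} (\<lambda>x. \<bar>q x\<bar>)"
proof -
  have "0 \<le> integral {a..b} (\<lambda>x. (u lam x)\<^sup>2)"
    by (intro integral_nonneg u_squared_integrable_on_Icc[OF assms(1)])
      auto
  then show ?thesis using energy_balance[OF assms] by linarith
qed

lemma u_du_le_energy:
  assumes "0 < c" "c \<le> lam - x" "energy lam x \<le> E"
  shows "2 * \<bar>u lam x * du lam x\<bar> \<le> E / sqrt c"
proof -
  have "2 * \<bar>du lam x\<bar> * (sqrt c * \<bar>u lam x\<bar>) \<le> (du lam x)\<^sup>2 + c * (u lam x)\<^sup>2"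
    using sum_squares_bound[of "\<bar>du lam x\<bar>" "sqrt c * \<bar>u lam x\<bar>"] \<open>0 < c\<close>
    by (simp add: power_mult_distrib)
  also have "\<dots> \<le> energy lam x"
    using assms(2) by (simp add: energy_def mult_right_mono)
  also have "\<dots> \<le> E" by fact
  finally have "2 * \<bar>u lam x * du lam x\<bar> * sqrt c \<le> E"
    by (simp add: abs_mult mult_ac)
  then show ?thesis
    using \<open>0 < c\<close> by (simp add: pos_le_divide_eq)
qed

text \<open>At its maximum on \<open>[0, lam - 1]\<close> the energy \<open>E\<close> satisfies \<open>E \<le> lam + E / 4 + E / 4\<close>.\<close>

lemma energy_le:
  assumes lam: "4 \<le> lam" "q_norm \<le> sqrt (lam / 2) / 4" and tail: "q_tail (lam / 2) \<le> 1/4"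
    and x: "x \<in> {0..lam - 1}"
  shows "energy lam x \<le> 2 * lam"
proof -
  have "\<exists>t\<in>{0..lam - 1}. \<forall>y\<in>{0..lam - 1}. energy lam y \<le> energy lam t"
    by (rule continuous_attains_sup)
      (use lam in \<open>auto intro: continuous_on_subset[OF continuous_energy]\<close>)
  then obtain t where t: "t \<in> {0..lam - 1}"
    and max: "\<And>y. y \<in> {0..lam - 1} \<Longrightarrow> energy lam y \<le> energy lam t" by blast
  define E where "E = energy lam t"
  have E_nonneg: "0 \<le> E" unfolding E_def energy_def using t by simp
  have left: "energy lam y \<le> lam + E / 4" if y: "0 \<le> y" "y \<le> lam / 2" for y
  proof -
    have "energy lam y - energy lam 0 \<le> (E / sqrt (lam / 2)) * integral {0..y} (\<lambda>x. \<bar>q x\<bar>)"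
      by (rule energy_increment_le) (use y lam max in \<open>auto intro!: u_du_le_energy simp: E_def\<close>)
    also have "\<dots> \<le> (E / sqrt (lam / 2)) * (sqrt (lam / 2) / 4)"
      using integral_abs_q_le_tail[of 0 0 y] lam E_nonneg by (intro mult_left_mono) auto
    also have "\<dots> = E / 4" using lam by (simp add: field_simps)
    finally show ?thesis by simp
  qed
  have "E \<le> lam + E / 4 + E / 4"
  proof (cases "t \<le> lam / 2")
    case True
    then show ?thesis using left[of t] t E_nonneg by (simp add: E_def)
  next
    case False
    have "energy lam t - energy lam (lam / 2) \<le> (E / sqrt 1) * integral {lam / 2..t} (\<lambda>x. \<bar>q x\<bar>)"
      by (rule energy_increment_le)
        (use False lam t max in \<open>auto intro!: u_du_le_energy simp: E_def simp del: real_sqrt_one\<close>)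
    also have "\<dots> \<le> E * (1/4)"
    proof -
      have "integral {lam / 2..t} (\<lambda>x. \<bar>q x\<bar>) \<le> 1/4"
        using integral_abs_q_le_tail[of "lam / 2" "lam / 2" t] tail lam by simp
      from mult_left_mono[OF this E_nonneg] show ?thesis by simp
    qed
    finally show ?thesis using left[of "lam / 2"] lam by (simp add: E_def)
  qed
  then have "E \<le> 2 * lam" by simp
  then show ?thesis using max[OF x] by (simp add: E_def)
qed

lemma q_tail_half_tendsto_0: "((\<lambda>lam. q_tail (lam / 2)) \<longlongrightarrow> 0) at_top"
  by (rule filterlim_compose[OF q_tail_tendsto_0]) real_asymp

lemma eventually_energy_le: "\<forall>\<^sub>F lam in at_top. \<forall>x\<in>{0..lam - 1}. energy lam x \<le> 2 * lam"
proof -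
  have "filterlim (\<lambda>lam::real. sqrt (lam / 2)) at_top at_top"
    by real_asymp
  then have "\<forall>\<^sub>F lam in at_top. 4 * q_norm \<le> sqrt (lam / 2)"
    by (simp add: filterlim_at_top)
  moreover have "\<forall>\<^sub>F lam in at_top. q_tail (lam / 2) < 1/4"
    by (rule order_tendstoD(2)[OF q_tail_half_tendsto_0]) simp
  ultimately show ?thesis
    using eventually_ge_at_top[of 4] by eventually_elim (auto intro!: energy_le)
qed

subsection \<open>Bounds for \<open>u u'\<close> beyond the turning point\<close>

lemma amp_squared_before_turning_point:
  assumes "1 \<le> lam"
  shows "(amp lam (lam - 1))\<^sup>2 \<le> (2 + 2 * q_norm\<^sup>2) * energy lam (lam - 1)"
proof -
  let ?a = "lam - 1"
  have "(v lam ?a)\<^sup>2 \<le> 2 * (du lam ?a)\<^sup>2 + 2 * ((Q ?a)\<^sup>2 * (u lam ?a)\<^sup>2)"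
    using zero_le_power2[of "du lam ?a + Q ?a * u lam ?a"]
    by (simp add: du_def power2_sum power_mult_distrib algebra_simps power2_eq_square)
  also have "(Q ?a)\<^sup>2 * (u lam ?a)\<^sup>2 \<le> q_norm\<^sup>2 * (u lam ?a)\<^sup>2"
    using assms by (intro mult_right_mono Q_power2_le) auto
  finally have "(amp lam ?a)\<^sup>2 \<le> 2 * (du lam ?a)\<^sup>2 + (1 + 2 * q_norm\<^sup>2) * (u lam ?a)\<^sup>2"
    by (simp add: distrib_right flip: u_squared_plus_v_squared)
  also have "\<dots> \<le> (2 + 2 * q_norm\<^sup>2) * (du lam ?a)\<^sup>2 + (2 + 2 * q_norm\<^sup>2) * (u lam ?a)\<^sup>2"
    by (intro add_mono mult_right_mono) auto
  finally show ?thesis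
    by (simp add: energy_def distrib_left)
qed

definition turning_growth :: real where
  "turning_growth = exp ((2 * q_norm + 1 + (2 * q_norm\<^sup>2 + 1)) * (q_norm\<^sup>2 + 2))"

lemma amp_squared_across_turning_point:
  assumes "1 \<le> lam" and x: "lam - 1 \<le> x" "x \<le> forbidden_start lam"
  shows "(amp lam x)\<^sup>2 \<le> (amp lam (lam - 1))\<^sup>2 * turning_growth"
proof -
  let ?L = "2 * q_norm + 1 + (2 * q_norm\<^sup>2 + 1)"
  have start_eq: "forbidden_start lam = lam + q_norm\<^sup>2 + 1"
    using assms(1) by (simp add: forbidden_start_eq)
  have "(u lam x)\<^sup>2 + (v lam x)\<^sup>2
        \<le> ((u lam (lam - 1))\<^sup>2 + (v lam (lam - 1))\<^sup>2) * exp (?L * (x - (lam - 1)))"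
  proof (rule quasi_solution_sum_squares_growth[OF quasi_solution_u_v])
    fix y assume y: "y \<in> {lam - 1..x}"
    then have "\<bar>y - lam\<bar> \<le> q_norm\<^sup>2 + 1"
      using x by (auto simp: start_eq abs_le_iff add_increasing)
    moreover have "\<bar>(Q y)\<^sup>2\<bar> \<le> q_norm\<^sup>2"
      using y assms(1) by (simp add: Q_power2_le)
    ultimately show "\<bar>quasi_potential lam y\<bar> \<le> 2 * q_norm\<^sup>2 + 1"
      unfolding quasi_potential_def by linarith
  qed (use assms in auto)
  also have "\<dots> \<le> ((u lam (lam - 1))\<^sup>2 + (v lam (lam - 1))\<^sup>2) * exp (?L * (q_norm\<^sup>2 + 2))"
    using x q_norm_nonneg
    by (intro mult_left_mono) (auto simp: start_eq intro!: mult_left_mono add_nonneg_nonneg)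
  finally show ?thesis
    by (simp add: u_squared_plus_v_squared turning_growth_def)
qed

lemma eigenvalue_u_squared_flux_le:
  assumes eig: "lam \<in> eigenvalues_N q" and x: "forbidden_start lam \<le> x"
  shows "(u lam x)\<^sup>2 \<le> (1 + 2 * q_norm) * (amp lam (forbidden_start lam))\<^sup>2"
    and "\<bar>flux lam x\<bar> \<le> (amp lam (forbidden_start lam))\<^sup>2"
proof -
  let ?b = "forbidden_start lam"
  have nonpos: "flux lam y \<le> 0" if "?b \<le> y" for y
    by (rule eigenvalue_flux_nonpos[OF eig that])
  have "flux lam ?b \<le> flux lam x"
    using flux_strict_mono[OF order_refl, of lam x] x by (cases "?b = x") auto
  then show flux: "\<bar>flux lam x\<bar> \<le> (amp lam ?b)\<^sup>2"
    using nonpos[OF x] abs_flux_le[of lam ?b] by linarith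
  have "integral {?b..x} (\<lambda>x. (u lam x)\<^sup>2) \<le> flux lam x - flux lam ?b"
    using integral_u_squared_le[OF forbidden_start_nonneg] integral_amp_squared_le[OF order_refl x]
    by (rule order_trans)
  also have "\<dots> \<le> (amp lam ?b)\<^sup>2"
    using nonpos[OF x] abs_flux_le[of lam ?b] by linarith
  finally have "2 * q_norm * integral {?b..x} (\<lambda>x. (u lam x)\<^sup>2) \<le> 2 * q_norm * (amp lam ?b)\<^sup>2"
    using q_norm_nonneg by (intro mult_left_mono) auto
  moreover have "integral {?b..x} (flux lam) \<le> integral {?b..x} (\<lambda>_. 0)"
    using nonpos
    by (intro integral_le flux_integrable_on_Icc[OF forbidden_start_nonneg])
      auto
  moreover have "(u lam ?b)\<^sup>2 \<le> (amp lam ?b)\<^sup>2"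
    by (rule u_squared_le_amp_squared)
  ultimately show "(u lam x)\<^sup>2 \<le> (1 + 2 * q_norm) * (amp lam ?b)\<^sup>2"
    using u_squared_increment[OF forbidden_start_nonneg x, of lam]
    by (simp add: distrib_right abs_le_iff)
qed

lemma abs_u_du_le:
  assumes "0 \<le> x"
  shows "\<bar>u lam x * du lam x\<bar> \<le> q_norm * (u lam x)\<^sup>2 + \<bar>flux lam x\<bar>"
proof -
  have "u lam x * du lam x = Q x * (u lam x)\<^sup>2 + flux lam x"
    by (simp add: du_def flux_def power2_eq_square algebra_simps)
  moreover have "\<bar>Q x * (u lam x)\<^sup>2\<bar> \<le> q_norm * (u lam x)\<^sup>2"
    unfolding abs_mult using abs_Q_le[OF assms] by (simp add: mult_right_mono)
  ultimately show ?thesis by linarith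
qed

lemma amp_squared_near_turning_point:
  assumes lam: "1 \<le> lam" "energy lam (lam - 1) \<le> 2 * lam"
    and x: "lam - 1 \<le> x" "x \<le> forbidden_start lam"
  shows "(amp lam x)\<^sup>2 \<le> (4 + 4 * q_norm\<^sup>2) * turning_growth * lam"
proof -
  have "(amp lam x)\<^sup>2 \<le> (amp lam (lam - 1))\<^sup>2 * turning_growth"
    by (rule amp_squared_across_turning_point[OF lam(1) x])
  also have "\<dots> \<le> ((2 + 2 * q_norm\<^sup>2) * (2 * lam)) * turning_growth"
  proof (intro mult_right_mono order_trans[OF amp_squared_before_turning_point[OF lam(1)]])
    show "(2 + 2 * q_norm\<^sup>2) * energy lam (lam - 1) \<le> (2 + 2 * q_norm\<^sup>2) * (2 * lam)"
      using lam(2) by (intro mult_left_mono) auto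
  qed (simp add: turning_growth_def)
  also have "\<dots> = (4 + 4 * q_norm\<^sup>2) * turning_growth * lam"
    by algebra
  finally show ?thesis .
qed

lemma eigenvalue_u_du_le:
  assumes eig: "lam \<in> eigenvalues_N q" and lam: "1 \<le> lam" "energy lam (lam - 1) \<le> 2 * lam"
    and x: "lam - 1 \<le> x"
  shows "2 * \<bar>u lam x * du lam x\<bar>
        \<le> 2 * (q_norm * (1 + 2 * q_norm) + 1) * ((4 + 4 * q_norm\<^sup>2) * turning_growth) * lam"
proof -
  define G where "G = (4 + 4 * q_norm\<^sup>2) * turning_growth * lam"
  have "0 \<le> G"
    using lam by (simp add: G_def turning_growth_def)
  note near = amp_squared_near_turning_point[OF lam, folded G_def]
  have "(u lam x)\<^sup>2 \<le> (1 + 2 * q_norm) * G \<and> \<bar>flux lam x\<bar> \<le> G"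
  proof (cases "x \<le> forbidden_start lam")
    case True
    have "(u lam x)\<^sup>2 \<le> (amp lam x)\<^sup>2"
      by (rule u_squared_le_amp_squared)
    also have "\<dots> \<le> G" by (rule near[OF x True])
    also have "\<dots> \<le> (1 + 2 * q_norm) * G"
      using mult_right_mono[of 1 "1 + 2 * q_norm" G] q_norm_nonneg \<open>0 \<le> G\<close> by simp
    finally show ?thesis
      using abs_flux_le[of lam x] near[OF x True] by linarith
  next
    case False
    have amp_start_le: "(amp lam (forbidden_start lam))\<^sup>2 \<le> G"
      using less_forbidden_start[of lam] by (intro near) auto
    then have "(1 + 2 * q_norm) * (amp lam (forbidden_start lam))\<^sup>2 \<le> (1 + 2 * q_norm) * G"
      using q_norm_nonneg by (intro mult_left_mono) simp_all
    then show ?thesis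
      using eigenvalue_u_squared_flux_le[OF eig, of x] False amp_start_le by auto
  qed
  then have "q_norm * (u lam x)\<^sup>2 + \<bar>flux lam x\<bar> \<le> q_norm * ((1 + 2 * q_norm) * G) + G"
    using q_norm_nonneg by (intro add_mono mult_left_mono) auto
  then have "2 * \<bar>u lam x * du lam x\<bar> \<le> 2 * (q_norm * ((1 + 2 * q_norm) * G) + G)"
    using abs_u_du_le[of x lam] x lam by simp
  also have "\<dots> = 2 * (q_norm * (1 + 2 * q_norm) + 1) * ((4 + 4 * q_norm\<^sup>2) * turning_growth) * lam"
    unfolding G_def by algebra
  finally show ?thesis .
qed

subsection \<open>Asymptotics of the norming constants\<close>

lemma abs_energy_le_form_density:
  assumes x: "forbidden_start lam \<le> x"
  shows "\<bar>energy lam x\<bar> \<le> (2 + 2 * q_norm\<^sup>2) * form_density lam x"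
proof -
  have "0 \<le> x" by (rule forbidden_start_le_imp_nonneg[OF x])
  define w p k where "w = (v lam x)\<^sup>2" and "p = quasi_potential lam x * (u lam x)\<^sup>2"
    and "k = (Q x)\<^sup>2 * (u lam x)\<^sup>2"
  have "(u lam x)\<^sup>2 \<le> form_density lam x"
    by (rule order_trans[OF u_squared_le_amp_squared amp_squared_le_form_density[OF x]])
  then have k_le: "k \<le> q_norm\<^sup>2 * form_density lam x"
    unfolding k_def by (intro mult_mono Q_power2_le \<open>0 \<le> x\<close>) auto
  have du_squared_le: "(du lam x)\<^sup>2 \<le> 2 * w + 2 * k"
    using zero_le_power2[of "v lam x - Q x * u lam x"]
    by (simp add: du_def w_def k_def power2_sum power2_diff power_mult_distrib algebra_simps)
  have "energy lam x = (du lam x)\<^sup>2 - p - k"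
    by (simp add: energy_def p_def k_def quasi_potential_def algebra_simps)
  moreover have "0 \<le> p"
    using quasi_potential_ge_1[OF x] by (simp add: p_def)
  moreover have "0 \<le> w" "0 \<le> k" "0 \<le> (du lam x)\<^sup>2" by (simp_all add: w_def k_def)
  moreover have "form_density lam x = w + p"
    by (simp add: form_density_def w_def p_def)
  ultimately have "\<bar>energy lam x\<bar> \<le> 2 * form_density lam x + 2 * k"
    using du_squared_le by linarith
  then show ?thesis
    using k_le by (simp add: algebra_simps)
qed

lemma eigenvalue_frequently_energy_small:
  assumes eig: "lam \<in> eigenvalues_N q" and "0 < e"
  shows "\<exists>\<^sub>F x in at_top. \<bar>energy lam x\<bar> < e"
proof -
  define K where "K = 2 + 2 * q_norm\<^sup>2"
  have "0 < K" by (simp add: K_def add_pos_nonneg)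
  have "\<exists>\<^sub>F x in at_top. form_density lam x < e / K"
  proof (rule frequently_less_of_bounded_integral)
    show "form_density lam integrable_on {forbidden_start lam..x}" for x
      by (rule form_density_integrable_on_Icc[OF forbidden_start_nonneg])
    show "integral {forbidden_start lam..x} (form_density lam) \<le> - flux lam (forbidden_start lam)"
      if "forbidden_start lam \<le> x" for x
      by (rule eigenvalue_integral_form_density_le[OF eig order_refl that])
  qed (use \<open>0 < e\<close> \<open>0 < K\<close> in simp)
  then have "\<exists>\<^sub>F x in at_top. form_density lam x < e / K \<and> forbidden_start lam \<le> x"
    by (rule frequently_eventually_frequently[OF _ eventually_ge_at_top])
  then show ?thesis
  proof (rule frequently_mono[rotated], intro allI impI)
    fix x assume "form_density lam x < e / K \<and> forbidden_start lam \<le> x"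
    then show "\<bar>energy lam x\<bar> < e"
      using abs_energy_le_form_density[of lam x] \<open>0 < K\<close>
      by (simp add: K_def[symmetric] pos_less_divide_eq mult.commute)
  qed
qed

lemma eigenvalue_integral_u_squared_tendsto:
  assumes "lam \<in> eigenvalues_N q"
  shows "((\<lambda>x. integral {0..x} (\<lambda>x. (u lam x)\<^sup>2)) \<longlongrightarrow> u_norm_sq lam) at_top"
  unfolding u_norm_sq_def using assms
  by (intro absolutely_integrable_tendsto_integral_atLeast nonnegative_absolutely_integrable_1)
    (auto simp: eigenvalue_iff_u_square_integrable)

lemma eigenvalue_u_norm_sq_bound:
  assumes eig: "lam \<in> eigenvalues_N q" and "0 \<le> c"
    and left: "\<And>x. x \<in> {0..c} \<Longrightarrow> 2 * \<bar>u lam x * du lam x\<bar> \<le> L"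
    and right: "\<And>x. c \<le> x \<Longrightarrow> 2 * \<bar>u lam x * du lam x\<bar> \<le> R"
  shows "\<bar>u_norm_sq lam - lam\<bar> \<le> L * q_norm + R * q_tail c"
proof (rule field_le_epsilon)
  fix e :: real assume "0 < e"
  define J where "J x = integral {0..x} (\<lambda>x. (u lam x)\<^sup>2)" for x
  have "(J \<longlongrightarrow> u_norm_sq lam) at_top"
    unfolding J_def by (rule eigenvalue_integral_u_squared_tendsto[OF eig])
  then have "\<forall>\<^sub>F x in at_top. dist (J x) (u_norm_sq lam) < e / 2"
    by (rule tendstoD) (use \<open>0 < e\<close> in simp)
  then have "\<forall>\<^sub>F x in at_top. dist (J x) (u_norm_sq lam) < e / 2 \<and> c \<le> x"
    using eventually_ge_at_top by (rule eventually_conj)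
  moreover have "\<exists>\<^sub>F x in at_top. \<bar>energy lam x\<bar> < e / 2"
    using \<open>0 < e\<close> by (intro eigenvalue_frequently_energy_small eig) simp
  ultimately have "\<exists>\<^sub>F x in at_top. \<bar>energy lam x\<bar> < e / 2
      \<and> (dist (J x) (u_norm_sq lam) < e / 2 \<and> c \<le> x)"
    by (rule frequently_eventually_frequently[rotated])
  then obtain x where x: "\<bar>energy lam x\<bar> < e / 2" "dist (J x) (u_norm_sq lam) < e / 2" "c \<le> x"
    by (auto dest: frequently_ex)
  have "0 \<le> L" "0 \<le> R"
    using left[of 0] right[of c] \<open>0 \<le> c\<close> by (auto intro: order_trans[rotated])
  have "\<bar>energy lam c - energy lam 0 + integral {0..c} (\<lambda>x. (u lam x)\<^sup>2)\<bar>
        \<le> L * integral {0..c} (\<lambda>x. \<bar>q x\<bar>)"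
    by (rule energy_balance[OF order_refl \<open>0 \<le> c\<close> left])
  also have "\<dots> \<le> L * q_norm"
    using \<open>0 \<le> L\<close> by (intro mult_left_mono integral_abs_q_le_tail) auto
  finally have balance_left: "\<bar>energy lam c - lam + J c\<bar> \<le> L * q_norm"
    by (simp add: J_def)
  have "\<bar>energy lam x - energy lam c + integral {c..x} (\<lambda>x. (u lam x)\<^sup>2)\<bar>
        \<le> R * integral {c..x} (\<lambda>x. \<bar>q x\<bar>)"
    by (rule energy_balance[OF \<open>0 \<le> c\<close> \<open>c \<le> x\<close>]) (use right in auto)
  also have "\<dots> \<le> R * q_tail c"
    using \<open>0 \<le> R\<close> \<open>0 \<le> c\<close> by (intro mult_left_mono integral_abs_q_le_tail) auto
  finally have balance_right: "\<bar>energy lam x - energy lam c + integral {c..x} (\<lambda>x. (u lam x)\<^sup>2)\<bar>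
        \<le> R * q_tail c" .
  have "J x - J c = integral {c..x} (\<lambda>x. (u lam x)\<^sup>2)"
    unfolding J_def
    by (intro integral_Icc_diff \<open>0 \<le> c\<close> \<open>c \<le> x\<close> u_squared_integrable_on_Icc order_refl)
  then show "\<bar>u_norm_sq lam - lam\<bar> \<le> L * q_norm + R * q_tail c + e"
    using balance_left balance_right x(1,2) unfolding dist_real_def by linarith
qed

lemma eventually_eigenvalue_u_norm_sq_bound:
  "\<exists>C. \<forall>\<^sub>F lam in at_top. lam \<in> eigenvalues_N q \<longrightarrow>
     \<bar>u_norm_sq lam - lam\<bar> \<le> 2 * lam / sqrt (lam / 2) * q_norm + C * lam * q_tail (lam / 2)"
proof -
  define C where "C = 2 * (q_norm * (1 + 2 * q_norm) + 1) * ((4 + 4 * q_norm\<^sup>2) * turning_growth)"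
  have "\<forall>\<^sub>F lam in at_top. lam \<in> eigenvalues_N q \<longrightarrow>
     \<bar>u_norm_sq lam - lam\<bar> \<le> 2 * lam / sqrt (lam / 2) * q_norm + max 2 C * lam * q_tail (lam / 2)"
    using eventually_energy_le eventually_ge_at_top[of 4]
  proof eventually_elim
    case (elim lam)
    show ?case
    proof (rule impI, rule eigenvalue_u_norm_sq_bound)
      fix x assume "x \<in> {0..lam / 2}"
      then show "2 * \<bar>u lam x * du lam x\<bar> \<le> 2 * lam / sqrt (lam / 2)"
        using elim by (intro u_du_le_energy) auto
    next
      fix x assume eig: "lam \<in> eigenvalues_N q" and x: "lam / 2 \<le> x"
      have "2 * \<bar>u lam x * du lam x\<bar> \<le> max (2 * lam) (C * lam)"
      proof (cases "x \<le> lam - 1")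
        case True
        then have "2 * \<bar>u lam x * du lam x\<bar> \<le> 2 * lam / sqrt 1"
          using elim x by (intro u_du_le_energy) auto
        then show ?thesis by simp
      next
        case False
        then have "2 * \<bar>u lam x * du lam x\<bar> \<le> C * lam"
          unfolding C_def using elim by (intro eigenvalue_u_du_le eig) auto
        then show ?thesis by simp
      qed
      also have "\<dots> = max 2 C * lam"
        using elim(2) by (simp add: max_mult_distrib_right)
      finally show "2 * \<bar>u lam x * du lam x\<bar> \<le> max 2 C * lam" .
    qed (use elim in auto)
  qed
  then show ?thesis by blast
qed

lemma u_norm_sq_asymp: "(\<lambda>m. u_norm_sq (mu m)) \<sim>[sequentially] mu"
proof -
  obtain C where u_norm_sq_bound: "\<forall>\<^sub>F lam in at_top. lam \<in> eigenvalues_N q \<longrightarrow>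
     \<bar>u_norm_sq lam - lam\<bar> \<le> 2 * lam / sqrt (lam / 2) * q_norm + C * lam * q_tail (lam / 2)"
    using eventually_eigenvalue_u_norm_sq_bound by blast
  define g where "g lam = 2 / sqrt (lam / 2) * q_norm + C * q_tail (lam / 2)" for lam
  have "((\<lambda>lam::real. 2 / sqrt (lam / 2)) \<longlongrightarrow> 0) at_top"
    by real_asymp
  then have "(g \<longlongrightarrow> 0 * q_norm + C * 0) at_top"
    unfolding g_def by (intro tendsto_intros q_tail_half_tendsto_0)
  then have g_mu: "((\<lambda>m. g (mu m)) \<longlongrightarrow> 0) sequentially"
    using filterlim_compose[OF _ filterlim_mu] by simp
  have "((\<lambda>m. u_norm_sq (mu m) / mu m - 1) \<longlongrightarrow> 0) sequentially"
  proof (rule Lim_null_comparison[OF _ g_mu])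
    have "\<forall>\<^sub>F lam in at_top. lam \<in> eigenvalues_N q \<longrightarrow> norm (u_norm_sq lam / lam - 1) \<le> g lam"
      using u_norm_sq_bound eventually_gt_at_top[of 0]
    proof eventually_elim
      case (elim lam)
      have "u_norm_sq lam / lam - 1 = (u_norm_sq lam - lam) / lam"
        "2 * lam / sqrt (lam / 2) * q_norm + C * lam * q_tail (lam / 2) = g lam * lam"
        using elim(2) by (simp_all add: g_def field_simps)
      then show ?case
        using elim by (simp add: abs_divide pos_divide_le_eq)
    qed
    from eventually_compose_filterlim[OF this filterlim_mu]
    show "\<forall>\<^sub>F m in sequentially. norm (u_norm_sq (mu m) / mu m - 1) \<le> g (mu m)"
      by (simp add: mu_eigenvalue)
  qed
  then show ?thesis
    by (intro asymp_equivI') (simp add: LIM_zero_iff)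
qed

end

theorem theorem3p9:
  fixes q :: "real \<Rightarrow> real"
  assumes "q absolutely_integrable_on {0..}"
  shows "inv_norming_const_N q \<sim>[at_top]
           (\<lambda>k. (3 / 2 * pi * (real k - 3 / 4)) powr (2 / 3))"
proof -
  interpret airy_potential q by unfold_locales (rule assms)
  show ?thesis
  proof (rule asymp_equiv_sequentially_SucD)
    show "(\<lambda>m. inv_norming_const_N q (Suc m))
        \<sim>[sequentially] (\<lambda>m. (3 / 2 * pi * (real (Suc m) - 3 / 4)) powr (2 / 3))"
      unfolding inv_norming_const_N_Suc by (rule asymp_equiv_trans[OF u_norm_sq_asymp mu_asymp])
  qed
qed

end
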